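(* Consider a $\nu$-stage penalized IMEX Runge-Kutta scheme with coefficients $(\tilde A,\tilde w,A,w)$ for the Boltzmann equation $\partial_t f+v\cdot\nabla_x f=\frac1\varepsilon Q_B(f)=\frac1\varepsilon G_P(f)+\frac1\varepsilon Q_P(f)$, i.e. $$F=f^n e+\Delta t\,\tilde A\left(\frac1\varepsilon G_P(F)+L(F)\right)+\frac{\Delta t}{\varepsilon}A\,Q_P(F),$$ $$f^{n+1}=f^n+\Delta t\,\tilde w^T\left(\frac1\varepsilon G_P(F)+L(F)\right)+\frac{\Delta t}{\varepsilon}w^T Q_P(F).$$ If the scheme is of type A (i.e. $A$ is invertible) and satisfies $$\tilde w^T=w^TA^{-1}\tilde A,$$ then, in the limit $\varepsilon\to0$ with $\Delta t$ fixed, the scheme becomes the explicit Runge-Kutta scheme characterized by $(\tilde A,\tilde w,\tilde c)$ applied to the Euler system $\partial_tU+\nabla_x\cdot\mathcal F(U)=0$. That is, in the limit each stage satisfies $F^{(i)}=M[F^{(i)}]$, and with $\mathcal U^{(i)}=\langle\phi F^{(i)}\rangle$, $U^n=\langle\phi f^n\rangle$, $$\mathcal U^{(i)}=U^n-\Delta t\sum_{j=1}^{i-1}\tilde a_{ij}\nabla_x\cdot\mathcal F(\mathcal U^{(j)}),\quad i=1,\dots,\nu,\qquad U^{n+1}=U^n-\Delta t\sum_{i=1}^{\nu}\tilde w_i\nabla_x\cdot\mathcal F(\mathcal U^{(i)}).$$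
   Context: Kinetic equation: $f=f(x,v,t)\ge0$, $v\in\mathbb R^3$, $x\in\Omega\subset\mathbb R^{d_x}$, $t>0$, Knudsen number $\varepsilon>0$. Notation: $\langle g\rangle=\int_{\mathbb R^3}g\,dv$, $\phi(v)=(1,v,|v|^2/2)^T$. Boltzmann operator: $Q_B(f)=\int_{\mathbb R^3\times S^2}B(|v-v_*|,n)[f(v')f(v'_* )-f(v)f(v_* )]\,dv_*\,dn$, $v'=v+\frac12(v-v_* )+\frac12|v-v_*|n$, $v'_*=v+\frac12(v-v_* )-\frac12|v-v_*|n$ in the paper's notation (the standard elastic post-collisional velocities), $B\ge0$ a collision kernel. The properties used are: $\langle\phi\,Q_B(f)\rangle=0$ for all $f$, and $Q_B(f)=0$ if and only if $f=M[f]$. Maxwellian: for a distribution $f$ with moments $(\rho,\rho u,E)^T=\langle\phi f\rangle$ and temperature $T=\frac1{3\rho}\langle|v-u|^2f\rangle$, $M[f]=\frac{\rho}{(2\pi T)^{3/2}}\exp\left(-\frac{|u-v|^2}{2T}\right)$, so $\langle\phi M[f]\rangle=\langle\phi f\rangle$. Penalization: $Q_P$ is an operator with $\langle\phi\,Q_P(f)\rangle=0$ for all $f$, and $Q_P(f)=0$ if and only if $f=M[f]$; $G_P(f)=Q_B(f)-Q_P(f)$. Euler system: $U=(\rho,\rho u,E)^T=\langle\phi M[f]\rangle$, $\mathcal F(U)=\langle v\phi M[f]\rangle=(\rho u,\rho u\otimes u+pI,Eu+pu)^T$, $p=\rho T$. Scheme: $\tilde A=(\tilde a_{ij})$, $A=(a_{ij})$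 are real $\nu\times\nu$ matrices with $\tilde a_{ij}=0$ for $j\ge i$ and $a_{ij}=0$ for $j>i$; $\tilde w,w\in\mathbb R^\nu$; $\tilde c_i=\sum_j\tilde a_{ij}$; $e=(1,\dots,1)^T\in\mathbb R^\nu$; $F=(F^{(1)},\dots,F^{(\nu)})^T$ are the stages; $L(F),G_P(F),Q_P(F)$ act componentwise, with $L(F^{(i)})=-v\cdot\nabla_xF^{(i)}$; $\Delta t>0$ is the time step; $n\ge0$. Convention on limits: the limit $\varepsilon\to0$ is formal. For fixed $\Delta t$, the ($\varepsilon$-dependent) numerical quantities $f^n$ and $F^{(i)}$ are assumed to converge as $\varepsilon\to0$, and $Q_P$, $G_P$, $L$, $M[\cdot]$ and the moments $\langle\cdot\rangle$ are assumed to commute with this limit; the statement is about the limiting quantities. *)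

theory Defs
  imports "HOL-Analysis.Analysis"
begin

type_synonym vel = "real ^ 3"

text \<open>Macroscopic states and moment vectors: (density, momentum, energy).\<close>
type_synonym state = "real \<times> (real ^ 3) \<times> real"

definition phi :: "vel \<Rightarrow> state" where
  "phi v = (1, v, (norm v)\<^sup>2 / 2)"

text \<open>The moments \<open>\<langle>\<phi> g\<rangle>\<close>. As a Bochner integral this is only meaningful where
  \<open>\<phi> g\<close> is integrable; integrability is therefore always demanded explicitly below.\<close>
definition moments :: "(vel \<Rightarrow> real) \<Rightarrow> state" where
  "moments g = (LINT v|lborel. g v *\<^sub>R phi v)"

definition mass_density :: "(vel \<Rightarrow> real) \<Rightarrow> real" where
  "mass_density g = fst (moments g)"

definition bulk_velocity :: "(vel \<Rightarrow> real) \<Rightarrow> real ^ 3" where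
  "bulk_velocity g = fst (snd (moments g)) /\<^sub>R mass_density g"

definition temperature :: "(vel \<Rightarrow> real) \<Rightarrow> real" where
  "temperature g =
     1 / (3 * mass_density g) * (LINT v|lborel. (norm (v - bulk_velocity g))\<^sup>2 * g v)"

definition maxwellian :: "(vel \<Rightarrow> real) \<Rightarrow> vel \<Rightarrow> real" where
  "maxwellian g v =
     mass_density g / (2 * pi * temperature g) powr (3 / 2)
       * exp (- (norm (bulk_velocity g - v))\<^sup>2 / (2 * temperature g))"

text \<open>Nonnegative, with finite mass, momentum and energy, and with positive density, so that
  the bulk velocity and the temperature are well defined.\<close>
definition distribution_function :: "(vel \<Rightarrow> real) \<Rightarrow> bool" where
  "distribution_function g \<longleftrightarrow>
     (\<forall>v. 0 \<le> g v) \<and> integrable lborel (\<lambda>v. g v *\<^sub>R phi v) \<and> 0 < mass_density g"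

text \<open>Surface measure of the unit sphere as a cone measure: a set \<open>S\<close> of directions gets
  three times the volume of the cone \<open>{r n | n \<in> S, 0 < r < 1}\<close> (total mass \<open>4 \<pi>\<close>).\<close>
definition sphere_measure :: "vel measure" where
  "sphere_measure =
     scale_measure 3
       (distr (restrict_space lborel (ball 0 1 - {0})) borel (\<lambda>y. y /\<^sub>R norm y))"

definition post_coll :: "vel \<Rightarrow> vel \<Rightarrow> vel \<Rightarrow> vel" where
  "post_coll v vs n = (1 / 2) *\<^sub>R (v + vs) + (norm (v - vs) / 2) *\<^sub>R n"

definition post_coll_star :: "vel \<Rightarrow> vel \<Rightarrow> vel \<Rightarrow> vel" where
  "post_coll_star v vs n = (1 / 2) *\<^sub>R (v + vs) - (norm (v - vs) / 2) *\<^sub>R n"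

definition boltzmann ::
  "(real \<Rightarrow> vel \<Rightarrow> real) \<Rightarrow> (vel \<Rightarrow> real) \<Rightarrow> vel \<Rightarrow> real" where
  "boltzmann B g v =
     (LINT (vs, n)|(lborel \<Otimes>\<^sub>M sphere_measure).
        B (norm (v - vs)) n
          * (g (post_coll v vs n) * g (post_coll_star v vs n) - g v * g vs))"

text \<open>In the next two definitions \<open>D\<close> is the class of distribution functions on which
  the operator acts.\<close>
definition conservative ::
  "(vel \<Rightarrow> real) set \<Rightarrow> ((vel \<Rightarrow> real) \<Rightarrow> vel \<Rightarrow> real) \<Rightarrow> bool" where
  "conservative D Q \<longleftrightarrow>
     (\<forall>g\<in>D. has_bochner_integral lborel (\<lambda>v. Q g v *\<^sub>R phi v) 0)"

definition maxwellian_equilibria ::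
  "(vel \<Rightarrow> real) set \<Rightarrow> ((vel \<Rightarrow> real) \<Rightarrow> vel \<Rightarrow> real) \<Rightarrow> bool" where
  "maxwellian_equilibria D Q \<longleftrightarrow>
     (\<forall>g\<in>D. (\<forall>v. Q g v = 0) \<longleftrightarrow> g = maxwellian g)"

definition penalized ::
  "(real \<Rightarrow> vel \<Rightarrow> real) \<Rightarrow> ((vel \<Rightarrow> real) \<Rightarrow> vel \<Rightarrow> real)
    \<Rightarrow> (vel \<Rightarrow> real) \<Rightarrow> vel \<Rightarrow> real" where
  "penalized B QP g v = boltzmann B g v - QP g v"

text \<open>The space dimension is \<open>CARD('d)\<close> and may be smaller than that of the velocity space. The
  map \<open>\<iota>\<close> says which velocity component moves which space coordinate:
  \<open>v \<cdot> \<nabla>\<^sub>x = (\<Sum>k. v\<^bsub>\<iota> k\<^esub> \<partial>\<^sub>k)\<close>.\<close>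
definition partial_x :: "'d::finite \<Rightarrow> (real ^ 'd \<Rightarrow> 'b::real_normed_vector) \<Rightarrow> real ^ 'd \<Rightarrow> 'b" where
  "partial_x k h x = frechet_derivative h (at x) (axis k 1)"

definition transport ::
  "('d::finite \<Rightarrow> 3) \<Rightarrow> (real ^ 'd \<Rightarrow> vel \<Rightarrow> real) \<Rightarrow> real ^ 'd \<Rightarrow> vel \<Rightarrow> real" where
  "transport \<iota> g x v = - (\<Sum>k\<in>UNIV. v $ \<iota> k * partial_x k (\<lambda>y. g y v) x)"

text \<open>Pressure \<open>p = \<rho> T\<close> as a function of the conserved variables, from
  \<open>3 \<rho> T = \<langle>|v - u|\<^sup>2 f\<rangle> = 2 E - \<rho> |u|\<^sup>2\<close>.\<close>
definition pressure :: "state \<Rightarrow> real" where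
  "pressure U = (case U of (\<rho>, m, E) \<Rightarrow> (2 * E - \<rho> * (norm (m /\<^sub>R \<rho>))\<^sup>2) / 3)"

text \<open>Column \<open>j\<close> of the flux \<open>(\<rho> u, \<rho> u \<otimes> u + p I, E u + p u)\<close>.\<close>
definition euler_flux :: "state \<Rightarrow> 3 \<Rightarrow> state" where
  "euler_flux U j =
     (case U of (\<rho>, m, E) \<Rightarrow>
        let u = m /\<^sub>R \<rho>; p = pressure U
        in (\<rho> * u $ j, (\<rho> * u $ j) *\<^sub>R u + p *\<^sub>R axis j 1, E * u $ j + p * u $ j))"

definition div_euler_flux ::
  "('d::finite \<Rightarrow> 3) \<Rightarrow> (real ^ 'd \<Rightarrow> state) \<Rightarrow> real ^ 'd \<Rightarrow> state" where
  "div_euler_flux \<iota> V x = (\<Sum>k\<in>UNIV. partial_x k (\<lambda>y. euler_flux (V y) (\<iota> k)) x)"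

text \<open>The stages are indexed by a finite type \<open>'s\<close>, so \<open>\<nu> = CARD('s)\<close>; for lower
  triangular coefficients the order of \<open>'s\<close> is the order of the stages. One step leads from
  \<open>f\<close> to \<open>f'\<close> through the stages \<open>F\<close>, on the spatial domain \<open>\<Omega>\<close>.\<close>
definition imex_step ::
  "('d::finite \<Rightarrow> 3) \<Rightarrow> (real ^ 'd) set
    \<Rightarrow> ((vel \<Rightarrow> real) \<Rightarrow> vel \<Rightarrow> real) \<Rightarrow> ((vel \<Rightarrow> real) \<Rightarrow> vel \<Rightarrow> real)
    \<Rightarrow> real ^ 's ^ 's \<Rightarrow> real ^ 's \<Rightarrow> real ^ 's ^ 's \<Rightarrow> real ^ 's
    \<Rightarrow> real \<Rightarrow> real
    \<Rightarrow> (real ^ 'd \<Rightarrow> vel \<Rightarrow> real) \<Rightarrow> ('s::finite \<Rightarrow> real ^ 'd \<Rightarrow> vel \<Rightarrow> real)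
    \<Rightarrow> (real ^ 'd \<Rightarrow> vel \<Rightarrow> real) \<Rightarrow> bool" where
  "imex_step \<iota> \<Omega> GP QP At wt A w dt \<epsilon> f F f' \<longleftrightarrow>
     (\<forall>x\<in>\<Omega>. \<forall>v.
        let ex = (\<chi> j. 1 / \<epsilon> * GP (F j x) v + transport \<iota> (F j) x v);
            im = (\<chi> j. QP (F j x) v)
        in (\<forall>i. F i x v = f x v + dt * (At *v ex) $ i + dt / \<epsilon> * (A *v im) $ i) \<and>
           f' x v = f x v + dt * (wt \<bullet> ex) + dt / \<epsilon> * (w \<bullet> im))"

end

theory Submission
  imports Defs "HOL-Probability.Distributions"
begin

text \<open>
  Multiplying a stage equation by \<open>\<epsilon>\<close> and letting \<open>\<epsilon> \<rightarrow> 0\<close> leaves only the stiff terms,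
  \<open>At G(F0) + A Q(F0) = 0\<close> with \<open>Q\<close> the penalization and \<open>G\<close> the penalized collision operator. As
  \<open>A\<close> is lower triangular and invertible its diagonal does not vanish, and \<open>At\<close> is strictly lower
  triangular, so the stages can be treated one after the other: if \<open>Q\<close> vanishes at all earlier
  stages, these are Maxwellians, hence zeros of the collision operator and of \<open>G\<close> too, and the
  equation of the present stage reduces to \<open>A\<^bsub>ii\<^esub> Q(F0\<^bsub>i\<^esub>) = 0\<close> (\<open>lower_triangular_cascade\<close>).
  So every limiting stage is a Maxwellian.

  For fixed \<open>\<epsilon>\<close> the collision terms have zero moments. The moments of a stage therefore contain
  no negative power of \<open>\<epsilon>\<close>, and their limit is the explicit scheme with the moments of the
  transport term as right-hand side. For the update, invertibility of \<open>A\<close>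
  allows the stage equations to be solved for the implicit terms, and the condition on the weights
  says that the explicit terms then cancel. With \<open>c = w\<^sup>T A\<inverse>\<close> one gets exactly, for every \<open>\<epsilon>\<close>,
  \<open>f\<^bsub>n+1\<^esub> = f\<^bsub>n\<^esub> + \<Sum>\<^sub>i c\<^sub>i (F\<^sub>i - f\<^bsub>n\<^esub>)\<close>
  (\<open>imex_step_update_from_stages\<close>). No singular term is left, so \<open>f\<^bsub>n+1\<^esub>\<close> converges together with
  its moments.

  The analytic part is the identity
  \<open>\<langle>\<phi> (v \<cdot> \<nabla>\<^sub>x) g\<rangle> = \<nabla>\<^sub>x \<cdot> \<F>(\<langle>\<phi> g\<rangle>)\<close> for a family \<open>g\<close> of Maxwellians
  (\<open>moments_transport_local_equilibrium\<close>). It has two ingredients. The flux \<open>\<langle>v\<^sub>j \<phi> g\<rangle>\<close> of a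
  Maxwellian is the Euler flux of its moments: only moments of order at most three in the peculiar
  velocity \<open>v - u\<close> occur, the odd ones vanish and the second ones are isotropic by symmetry, and the
  mass and the temperature are the given moments of \<open>g\<close> (\<open>local_equilibrium_flux\<close>). The derivative
  in \<open>x\<close> can be taken inside this integral. Nothing but differentiability of \<open>g\<close> in \<open>x\<close> at each single
  velocity is known, but the logarithm of a Maxwellian is a quadratic polynomial in \<open>v\<close> whose
  coefficients can be read off from seven velocities. So these coefficients are differentiable, which
  yields a difference bound by \<open>\<bar>y - x\<bar>\<close> times an integrable function of \<open>v\<close>
  (\<open>local_equilibrium_family_Lipschitz_bound\<close>), and dominated convergence applies.
\<close>

section \<open>Differentiation under the integral sign\<close>

text \<open>
  Differentiability is available only at the single point \<open>x\<close>, so the domination is imposed on the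
  increments from \<open>x\<close>. It passes to the limit of the difference quotients and then also
  bounds \<open>f' v h\<close>, which makes \<open>2 w\<close> a dominating function for the normalized remainders.
\<close>
lemma has_derivative_integral_dominated:
  fixes f :: "'a::real_normed_vector \<Rightarrow> 'm \<Rightarrow> 'b::{banach, second_countable_topology}"
  assumes deriv: "\<And>v. ((\<lambda>y. f y v) has_derivative f' v) (at x)"
    and int_x: "integrable M (f x)"
    and int_y: "eventually (\<lambda>y. integrable M (f y)) (at x)"
    and bound: "eventually (\<lambda>y. \<forall>v. norm (f y v - f x v) \<le> w v * norm (y - x)) (at x)"
    and w: "integrable M w"
  shows "integrable M (\<lambda>v. f' v h)"
    and "((\<lambda>y. LINT v|M. f y v) has_derivative (\<lambda>h. LINT v|M. f' v h)) (at x)"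
proof -
  from int_y bound have "eventually (\<lambda>y. integrable M (f y) \<and>
      (\<forall>v. norm (f y v - f x v) \<le> w v * norm (y - x))) (at x)"
    by eventually_elim auto
  then obtain d where d: "d > 0"
    and near: "\<And>y. y \<noteq> x \<Longrightarrow> dist y x < d \<Longrightarrow> integrable M (f y)"
      "\<And>y v. y \<noteq> x \<Longrightarrow> dist y x < d \<Longrightarrow> norm (f y v - f x v) \<le> w v * norm (y - x)"
    by (auto simp: eventually_at)
  have lin: "bounded_linear (f' v)" for v
    using deriv has_derivative_bounded_linear by blast
  have limit_quotient: "integrable M (\<lambda>v. f' v h) \<and> (\<forall>v. norm (f' v h) \<le> w v * norm h)" for h
  proof (cases "h = 0")
    case True
    then show ?thesis
      using linear_0[OF bounded_linear.linear[OF lin]] by simp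
  next
    case False
    \<comment> \<open>Scaled so that every \<open>x + t n *\<^sub>R h\<close> lies in the ball where the hypotheses hold.\<close>
    define t where "t n = d / (1 + norm h) * inverse (real (Suc n))" for n
    define q where "q n v = (f (x + t n *\<^sub>R h) v - f x v) /\<^sub>R t n" for n v
    have t_pos: "t n > 0" for n
      using d by (auto simp: t_def intro!: mult_pos_pos divide_pos_pos add_pos_nonneg)
    have t_lim: "t \<longlonglongrightarrow> 0"
      unfolding t_def using tendsto_mult_right_zero[OF LIMSEQ_inverse_real_of_nat] by blast
    have t_small: "t n * norm h < d" for n
    proof -
      have "norm h * inverse (real (Suc n)) \<le> norm h * 1"
        by (intro mult_left_mono) (auto simp: field_simps)
      also have "\<dots> < 1 + norm h" by simp
      finally have "norm h * inverse (real (Suc n)) / (1 + norm h) < 1"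
        by (subst pos_divide_less_eq) (auto intro: add_pos_nonneg)
      then have "d * (norm h * inverse (real (Suc n)) / (1 + norm h)) < d * 1"
        using d by (intro mult_strict_left_mono)
      then show ?thesis by (simp add: t_def mult_ac)
    qed
    have ne: "x + t n *\<^sub>R h \<noteq> x" for n
      using t_pos[of n] False by auto
    have dist: "dist (x + t n *\<^sub>R h) x < d" for n
      using t_small[of n] t_pos[of n] by (simp add: dist_norm)
    have q_lim: "(\<lambda>n. q n v) \<longlonglongrightarrow> f' v h" for v
    proof -
      have "((\<lambda>s. f (x + s *\<^sub>R h) v) has_derivative (\<lambda>s. f' v (s *\<^sub>R h))) (at 0)"
        by (rule has_derivative_compose[of "\<lambda>s. x + s *\<^sub>R h" "\<lambda>s. s *\<^sub>R h" 0 UNIV "\<lambda>y. f y v"])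
           (use deriv in \<open>auto intro!: derivative_eq_intros\<close>)
      then have "((\<lambda>s. norm (f (x + s *\<^sub>R h) v - f x v - s *\<^sub>R f' v h) / norm s) \<longlongrightarrow> 0) (at 0)"
        by (simp add: has_derivative_at linear_scale[OF bounded_linear.linear[OF lin]])
      then have "((\<lambda>s. norm ((f (x + s *\<^sub>R h) v - f x v) /\<^sub>R s - f' v h)) \<longlongrightarrow> 0) (at 0)"
      proof (rule Lim_transform_eventually)
        have "norm (f (x + s *\<^sub>R h) v - f x v - s *\<^sub>R f' v h) / norm s
          = norm ((f (x + s *\<^sub>R h) v - f x v) /\<^sub>R s - f' v h)" if "s \<noteq> 0" for s
        proof -
          have "(f (x + s *\<^sub>R h) v - f x v) /\<^sub>R s - f' v h
            = (f (x + s *\<^sub>R h) v - f x v - s *\<^sub>R f' v h) /\<^sub>R s"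
            using that by (simp add: scaleR_diff_right)
          then show ?thesis by (simp add: divide_inverse mult.commute)
        qed
        then show "\<forall>\<^sub>F s in at 0. norm (f (x + s *\<^sub>R h) v - f x v - s *\<^sub>R f' v h) / norm s
          = norm ((f (x + s *\<^sub>R h) v - f x v) /\<^sub>R s - f' v h)"
          by (auto simp: eventually_at intro!: exI[of _ 1])
      qed
      then have "((\<lambda>s. (f (x + s *\<^sub>R h) v - f x v) /\<^sub>R s) \<longlongrightarrow> f' v h) (at 0)"
        by (simp add: tendsto_norm_zero_iff Lim_null[of _ "f' v h"])
      moreover have "filterlim t (at 0) sequentially"
        using t_lim t_pos by (auto simp: filterlim_at eventually_sequentially less_imp_neq[symmetric])
      ultimately show ?thesis
        unfolding q_def using filterlim_compose by blast
    qed
    have q_bound: "norm (q n v) \<le> w v * norm h" for n v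
    proof -
      have "norm (q n v) = norm (f (x + t n *\<^sub>R h) v - f x v) / t n"
        using t_pos[of n] by (simp add: q_def divide_inverse)
      also have "\<dots> \<le> (w v * (t n * norm h)) / t n"
        using near(2)[OF ne dist, of n v] t_pos[of n] by (intro divide_right_mono) auto
      finally show ?thesis using t_pos[of n] by simp
    qed
    have lim_bound: "norm (f' v h) \<le> w v * norm h" for v
      by (rule LIMSEQ_le_const2[OF tendsto_norm[OF q_lim]]) (use q_bound in auto)
    have meas: "(\<lambda>v. f' v h) \<in> borel_measurable M"
    proof (rule borel_measurable_LIMSEQ_metric[where f = q])
      show "q n \<in> borel_measurable M" for n
        using near(1)[OF ne dist, of n] int_x unfolding q_def by simp
    qed (use q_lim in auto)
    have "integrable M (\<lambda>v. f' v h)"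
      by (rule Bochner_Integration.integrable_bound[OF integrable_mult_left[OF w, of "norm h"] meas])
        (use lim_bound in \<open>auto intro: order_trans[OF _ abs_ge_self]\<close>)
    with lim_bound show ?thesis by simp
  qed
  then show int': "integrable M (\<lambda>v. f' v h)" for h by simp
  have bd: "norm (f' v h) \<le> w v * norm h" for v h using limit_quotient by simp
  show "((\<lambda>y. LINT v|M. f y v) has_derivative (\<lambda>h. LINT v|M. f' v h)) (at x)"
    unfolding has_derivative_at2 
  proof (intro conjI)
    show "bounded_linear (\<lambda>h. LINT v|M. f' v h)"
    proof (rule bounded_linear_intro)
      show "(LINT v|M. f' v (a + b)) = (LINT v|M. f' v a) + (LINT v|M. f' v b)" for a b
        by (simp add: linear_add[OF bounded_linear.linear[OF lin]] int')
      show "(LINT v|M. f' v (r *\<^sub>R a)) = r *\<^sub>R (LINT v|M. f' v a)" for r a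
        by (simp add: linear_scale[OF bounded_linear.linear[OF lin]])
      fix h
      have "norm (LINT v|M. f' v h) \<le> (LINT v|M. norm (f' v h))"
        by (rule integral_norm_bound)
      also have "\<dots> \<le> (LINT v|M. w v * norm h)"
        using bd by (intro integral_mono) (auto intro: int' w)
      finally show "norm (LINT v|M. f' v h) \<le> norm h * (LINT v|M. w v)"
        by (simp add: mult.commute)
    qed
    show "((\<lambda>y. (1 / norm (y - x)) *\<^sub>R ((LINT v|M. f y v) - ((LINT v|M. f x v)
        + (LINT v|M. f' v (y - x))))) \<longlongrightarrow> 0) (at x)"
      unfolding tendsto_at_iff_sequentially
    proof (intro allI impI)
      fix X assume X: "\<forall>i. X i \<in> UNIV - {x}" and "X \<longlonglongrightarrow> x"
      then obtain N where N: "\<And>n. n \<ge> N \<Longrightarrow> dist (X n) x < d"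
        using d unfolding lim_sequentially by metis
      define r where "r n v = (1 / norm (X (n + N) - x)) *\<^sub>R
        (f (X (n + N)) v - (f x v + f' v (X (n + N) - x)))" for n v
      have X': "(\<lambda>n. X (n + N)) \<longlonglongrightarrow> x" by (rule LIMSEQ_ignore_initial_segment) fact
      have ne: "X n \<noteq> x" for n using X by auto
      have intX: "integrable M (f (X (n + N)))" for n
        using near(1)[OF ne N] by simp
      have "(\<lambda>n. LINT v|M. r n v) \<longlonglongrightarrow> (LINT v|M. 0)"
      proof (rule integral_dominated_convergence[where w = "\<lambda>v. 2 * w v"])
        show "r n \<in> borel_measurable M" for n
          unfolding r_def using intX int_x int' by (intro borel_measurable_scaleR) auto
        show "integrable M (\<lambda>v. 2 * w v)" using w by simp
        show "AE v in M. (\<lambda>n. r n v) \<longlonglongrightarrow> 0"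
        proof (rule AE_I2)
          fix v
          have "((\<lambda>y. (1 / norm (y - x)) *\<^sub>R (f y v - (f x v + f' v (y - x)))) \<longlongrightarrow> 0) (at x)"
            using deriv[of v] unfolding has_derivative_at2 by simp
          moreover have "filterlim (\<lambda>n. X (n + N)) (at x) sequentially"
            using X' ne by (simp add: filterlim_at)
          ultimately show "(\<lambda>n. r n v) \<longlonglongrightarrow> 0"
            unfolding r_def using filterlim_compose by blast
        qed
        show "AE v in M. norm (r n v) \<le> 2 * w v" for n
        proof (rule AE_I2)
          fix v
          have pos: "norm (X (n + N) - x) > 0" using ne by simp
          have "norm (f (X (n + N)) v - (f x v + f' v (X (n + N) - x)))
            \<le> norm (f (X (n + N)) v - f x v) + norm (f' v (X (n + N) - x))"
            by (metis diff_diff_eq norm_triangle_ineq4)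
          also have "\<dots> \<le> w v * norm (X (n + N) - x) + w v * norm (X (n + N) - x)"
            by (intro add_mono near(2) bd ne N) simp
          finally show "norm (r n v) \<le> 2 * w v"
            using pos by (simp add: r_def pos_divide_le_eq mult.commute)
        qed
      qed simp
      moreover have "(LINT v|M. r n v) = (1 / norm (X (n + N) - x)) *\<^sub>R
          ((LINT v|M. f (X (n + N)) v) - ((LINT v|M. f x v) + (LINT v|M. f' v (X (n + N) - x))))" for n
        unfolding r_def using intX int_x int' by simp
      ultimately have "(\<lambda>n. ((\<lambda>y. (1 / norm (y - x)) *\<^sub>R ((LINT v|M. f y v) - ((LINT v|M. f x v)
        + (LINT v|M. f' v (y - x))))) \<circ> X) (n + N)) \<longlonglongrightarrow> 0" by (simp add: o_def)
      then show "(((\<lambda>y. (1 / norm (y - x)) *\<^sub>R ((LINT v|M. f y v) - ((LINT v|M. f x v)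
        + (LINT v|M. f' v (y - x))))) \<circ> X)) \<longlonglongrightarrow> 0" by (rule LIMSEQ_offset)
    qed
  qed
qed

section \<open>Gaussian integrals and rotational symmetry\<close>

lemma integrable_exp_neg_square:
  fixes a :: real assumes "a > 0"
  shows "integrable lborel (\<lambda>v::'a::euclidean_space. exp (- a * (norm v)\<^sup>2))"
proof (rule integrableI_nonneg)
  \<comment> \<open>In one dimension this is a multiple of the normal density with variance \<open>1 / (2 a)\<close>.\<close>
  have one: "integrable lborel (\<lambda>x::real. exp (- a * x\<^sup>2))"
  proof -
    have "integrable lborel (\<lambda>x. sqrt (2 * pi * (1 / sqrt (2 * a))\<^sup>2) * normal_density 0 (1 / sqrt (2 * a)) x)"
      using assms by (intro integrable_mult_right integrable_normal_density) auto
    also have "(\<lambda>x. sqrt (2 * pi * (1 / sqrt (2 * a))\<^sup>2) * normal_density 0 (1 / sqrt (2 * a)) x)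
       = (\<lambda>x. exp (- a * x\<^sup>2))"
      using assms by (auto simp: normal_density_def power_divide field_simps)
    finally show ?thesis .
  qed
  have "(\<integral>\<^sup>+(v::'a). ennreal (exp (- a * (norm v)\<^sup>2)) \<partial>lborel)
     = (\<integral>\<^sup>+(v::'a). (\<Prod>b\<in>Basis. ennreal (exp (- a * (v \<bullet> b)\<^sup>2))) \<partial>lborel)"
  proof (intro nn_integral_cong)
    fix v :: 'a
    have "(norm v)\<^sup>2 = (\<Sum>b\<in>Basis. (v \<bullet> b)\<^sup>2)"
      by (simp add: power2_norm_eq_inner power2_eq_square[of "_ \<bullet> _"] flip: euclidean_inner)
    then show "ennreal (exp (- a * (norm v)\<^sup>2)) = (\<Prod>b\<in>Basis. ennreal (exp (- a * (v \<bullet> b)\<^sup>2)))"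
      by (simp add: prod_ennreal exp_sum[symmetric] sum_distrib_left sum_negf)
  qed
  also have "\<dots> = (\<Prod>b\<in>(Basis::'a set). \<integral>\<^sup>+x. ennreal (exp (- a * x\<^sup>2)) \<partial>lborel)"
    using nn_integral_lborel_prod[where 'a = 'a and f = "\<lambda>_ x. exp (- a * x\<^sup>2)"] by (simp add: prod_ennreal)
  also have "\<dots> < \<infinity>"
  proof -
    have "(\<integral>\<^sup>+x. ennreal (exp (- a * x\<^sup>2)) \<partial>lborel) < \<infinity>"
      using one by (simp add: integrable_iff_bounded)
    then show ?thesis by (simp add: power_less_top_ennreal)
  qed
  finally show "(\<integral>\<^sup>+(v::'a). ennreal (exp (- a * (norm v)\<^sup>2)) \<partial>lborel) < \<infinity>" .
qed auto

text \<open>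
  A power costs only half of the Gaussian decay: \<open>(1 + r)\<^sup>n \<le> e\<^bsup>nr\<^esup>\<close>, and
  \<open>n r \<le> a r\<^sup>2 / 2 + n\<^sup>2 / (2 a)\<close> by completing the square.
\<close>
lemma power_mult_exp_neg_square_le:
  fixes r a :: real assumes "r \<ge> 0" "a > 0"
  shows "(1 + r) ^ n * exp (- a * r\<^sup>2) \<le> exp ((real n)\<^sup>2 / (2 * a)) * exp (- (a / 2) * r\<^sup>2)"
proof -
  have "(1 + r) ^ n \<le> exp r ^ n"
    using assms by (intro power_mono) auto
  also have "\<dots> = exp (n * r)" by (simp add: exp_of_nat_mult)
  finally have "(1 + r) ^ n * exp (- a * r\<^sup>2) \<le> exp (n * r) * exp (- a * r\<^sup>2)" by simp
  also have "\<dots> = exp (n * r - a * r\<^sup>2)" by (simp add: exp_add[symmetric])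
  also have "\<dots> \<le> exp ((real n)\<^sup>2 / (2 * a) - (a / 2) * r\<^sup>2)"
  proof -
    have "0 \<le> (a * r - n)\<^sup>2 / (2 * a)" using assms by simp
    also have "\<dots> = (real n)\<^sup>2 / (2 * a) + a / 2 * r\<^sup>2 - n * r"
      using assms by (simp add: field_simps power2_eq_square)
    finally show ?thesis by (simp add: field_simps)
  qed
  finally show ?thesis by (simp add: exp_add[symmetric])
qed

lemma integrable_power_mult_exp_neg_square:
  fixes a :: real assumes "a > 0"
  shows "integrable lborel (\<lambda>v::'a::euclidean_space. (1 + norm v) ^ n * exp (- a * (norm v)\<^sup>2))"
proof (rule Bochner_Integration.integrable_bound)
  show "integrable lborel (\<lambda>v::'a. exp ((real n)\<^sup>2 / (2 * a)) * exp (- (a / 2) * (norm v)\<^sup>2))"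
    by (intro integrable_mult_right integrable_exp_neg_square) (use assms in simp)
qed (use assms power_mult_exp_neg_square_le in auto)

lemma lborel_distr_orthogonal_transformation:
  fixes f :: "real ^ ('n::{finite,wellorder}) \<Rightarrow> real ^ ('n::{finite,wellorder})"
  assumes f: "orthogonal_transformation f"
  shows "distr lborel borel f = lborel"
proof (rule lborel_eqI[symmetric])
  have [measurable]: "f \<in> borel_measurable borel"
    using f by (intro borel_measurable_continuous_onI linear_continuous_on)
      (auto simp: orthogonal_transformation_def linear_conv_bounded_linear)
  fix l u :: "real ^ ('n::{finite,wellorder})" assume le: "\<And>b. b \<in> Basis \<Longrightarrow> l \<bullet> b \<le> u \<bullet> b"
  have box: "box l u \<in> lmeasurable" by simp
  have eq: "f -` box l u = inv f ` box l u"
    using orthogonal_transformation_bij[OF f] by (simp add: bij_vimage_eq_inv_image)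
  have inv: "orthogonal_transformation (inv f)"
    by (rule orthogonal_transformation_inv[OF f])
  have meas: "f -` box l u \<in> lmeasurable"
    unfolding eq by (rule measurable_orthogonal_image[OF inv box])
  have "emeasure (distr lborel borel f) (box l u) = emeasure lborel (f -` box l u)"
    by (simp add: emeasure_distr)
  also have "\<dots> = emeasure lebesgue (f -` box l u)"
    using measurable_sets_borel[of f borel "box l u"] by (simp add: emeasure_completion)
  also have "\<dots> = ennreal (measure lebesgue (inv f ` box l u))"
    using emeasure_eq_measure2[OF meas] by (simp add: eq)
  also have "\<dots> = ennreal (measure lebesgue (box l u))"
    by (simp add: measure_orthogonal_image[OF inv box])
  also have "\<dots> = emeasure lebesgue (box l u)"
    using emeasure_eq_measure2[OF box] by simp
  also have "\<dots> = ennreal (\<Prod>b\<in>Basis. (u - l) \<bullet> b)"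
    using le by simp
  finally show "emeasure (distr lborel borel f) (box l u) = ennreal (\<Prod>b\<in>Basis. (u - l) \<bullet> b)" .
qed simp

lemma has_bochner_integral_lborel_orthogonal_transformation:
  fixes f :: "real ^ ('n::{finite,wellorder}) \<Rightarrow> real ^ ('n::{finite,wellorder})"
    and h :: "real ^ ('n::{finite,wellorder}) \<Rightarrow> 'b::{banach, second_countable_topology}"
  assumes f: "orthogonal_transformation f" and h: "has_bochner_integral lborel h c"
  shows "has_bochner_integral lborel (\<lambda>v. h (f v)) c"
proof -
  have [measurable]: "f \<in> borel_measurable borel"
    using f by (intro borel_measurable_continuous_onI linear_continuous_on)
      (auto simp: orthogonal_transformation_def linear_conv_bounded_linear)
  have "has_bochner_integral (distr lborel borel f) h c"
    using h by (simp add: lborel_distr_orthogonal_transformation[OF f])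
  moreover have "h \<in> borel_measurable borel"
    using borel_measurable_has_bochner_integral[OF h] by simp
  ultimately show ?thesis
    by (simp add: has_bochner_integral_iff integrable_distr_eq integral_distr)
qed

lemma has_bochner_integral_lborel_translation:
  fixes h :: "'a::euclidean_space \<Rightarrow> 'b::{banach, second_countable_topology}"
  assumes h: "has_bochner_integral lborel h c"
  shows "has_bochner_integral lborel (\<lambda>v. h (u + v)) c"
proof -
  have "has_bochner_integral (distr lborel borel ((+) u)) h c"
    using h by (simp add: lborel_distr_plus)
  moreover have "h \<in> borel_measurable borel"
    using borel_measurable_has_bochner_integral[OF h] by simp
  ultimately show ?thesis
    by (simp add: has_bochner_integral_iff integrable_distr_eq integral_distr)
qed

lemma has_bochner_integral_odd:
  fixes h :: "real ^ ('n::{finite,wellorder}) \<Rightarrow> 'b::{banach, second_countable_topology}"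
  assumes h: "integrable lborel h" and odd: "\<And>v. h (- v) = - h v"
  shows "has_bochner_integral lborel h 0"
proof -
  have "orthogonal_transformation (uminus :: real ^ ('n::{finite,wellorder}) \<Rightarrow> real ^ ('n::{finite,wellorder}))"
    by (simp add: orthogonal_transformation_def linear_uminus)
  from has_bochner_integral_lborel_orthogonal_transformation[OF this has_bochner_integral_integrable[OF h]]
  have "has_bochner_integral lborel (\<lambda>v. - h v) (integral\<^sup>L lborel h)" by (simp add: odd)
  then have "- integral\<^sup>L lborel h = integral\<^sup>L lborel h"
    by (simp add: has_bochner_integral_iff)
  then have "2 *\<^sub>R integral\<^sup>L lborel h = 0" by (simp add: scaleR_2 neg_eq_iff_add_eq_0)
  then have "integral\<^sup>L lborel h = 0" by simp
  then show ?thesis using h by (simp add: has_bochner_integral_iff)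
qed

text \<open>
  Reflecting the \<open>i\<close>-th coordinate changes the sign of a mixed moment, and exchanging two
  coordinates shows that the diagonal moments agree; each of them is then the same share of the
  trace \<open>m\<close>.
\<close>
lemma has_bochner_integral_radial_second_moments:
  fixes h :: "real ^ ('n::{finite,wellorder}) \<Rightarrow> real"
  assumes radial: "\<And>v w. norm v = norm w \<Longrightarrow> h v = h w"
    and meas [measurable]: "h \<in> borel_measurable borel"
    and m: "has_bochner_integral lborel (\<lambda>v. (norm v)\<^sup>2 * h v) m"
  shows "has_bochner_integral lborel (\<lambda>v. v $ i * v $ j * h v) (if i = j then m / CARD('n) else 0)"
proof -
  have int: "integrable lborel (\<lambda>v. v $ k * v $ l * h v)" for k l
  proof (rule Bochner_Integration.integrable_bound)
    show "integrable lborel (\<lambda>v. (norm v)\<^sup>2 * h v)" using m by (simp add: has_bochner_integral_iff)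
    show "(\<lambda>v. v $ k * v $ l * h v) \<in> borel_measurable lborel"
      by measurable
    have "norm (v $ k * v $ l * h v) \<le> norm ((norm v)\<^sup>2 * h v)" for v
      by (auto simp: abs_mult power2_eq_square intro!: mult_right_mono mult_mono component_le_norm_cart)
    then show "AE v in lborel. norm (v $ k * v $ l * h v) \<le> norm ((norm v)\<^sup>2 * h v)" by simp
  qed
  define I where "I k l = (LINT v|lborel. v $ k * v $ l * h v)" for k l
  have hbi: "has_bochner_integral lborel (\<lambda>v. v $ k * v $ l * h v) (I k l)" for k l
    using int unfolding I_def by (rule has_bochner_integral_integrable)
  have off: "I i j = 0" if "i \<noteq> j"
  proof -
    define R :: "real ^ ('n::{finite,wellorder}) \<Rightarrow> real ^ ('n::{finite,wellorder})" where "R v = (\<chi> k. if k = i then - v $ k else v $ k)" for v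
    have R: "orthogonal_transformation R"
      unfolding orthogonal_transformation_def
      by (auto simp: R_def linear_iff vec_eq_iff inner_vec_def intro!: sum.cong)
    then have "h (R v) = h v" for v
      by (intro radial) (simp add: orthogonal_transformation_norm)
    moreover have "R v $ i * R v $ j = - (v $ i * v $ j)" for v
      using that by (simp add: R_def)
    ultimately have "has_bochner_integral lborel (\<lambda>v. - (v $ i * v $ j * h v)) (I i j)"
      using has_bochner_integral_lborel_orthogonal_transformation[OF R hbi[of i j]] by simp
    moreover have "has_bochner_integral lborel (\<lambda>v. - (v $ i * v $ j * h v)) (- I i j)"
      using has_bochner_integral_minus[OF hbi[of i j]] by simp
    ultimately have "I i j = - I i j" by (rule has_bochner_integral_eq)
    then show ?thesis by simp
  qed
  have diag: "I k k = I i i" for k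
  proof -
    define P :: "real ^ ('n::{finite,wellorder}) \<Rightarrow> real ^ ('n::{finite,wellorder})" where "P v = (\<chi> l. v $ Transposition.transpose i k l)" for v
    have P: "orthogonal_transformation P"
      unfolding orthogonal_transformation_def
    proof (intro conjI allI)
      show "linear P" by (auto simp: P_def linear_iff vec_eq_iff)
      show "P v \<bullet> P w = v \<bullet> w" for v w
        unfolding inner_vec_def P_def vec_lambda_beta
        by (rule sum.reindex_bij_betw[OF bij_transpose])
    qed
    then have "h (P v) = h v" for v
      by (intro radial) (simp add: orthogonal_transformation_norm)
    then have "has_bochner_integral lborel (\<lambda>v. v $ k * v $ k * h v) (I i i)"
      using has_bochner_integral_lborel_orthogonal_transformation[OF P hbi[of i i]]
      by (simp add: P_def)
    then show ?thesis using hbi has_bochner_integral_eq by blast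
  qed
  have "has_bochner_integral lborel (\<lambda>v. \<Sum>k\<in>UNIV. v $ k * v $ k * h v) (\<Sum>k\<in>UNIV. I k k)"
    by (intro has_bochner_integral_sum hbi)
  moreover have "(\<Sum>k\<in>UNIV. v $ k * v $ k * h v) = (norm v)\<^sup>2 * h v" for v
    by (simp add: power2_norm_eq_inner inner_vec_def sum_distrib_right)
  moreover have "(\<Sum>k\<in>UNIV. I k k) = CARD('n) * I i i"
    by (subst diag) simp
  ultimately have "m = CARD('n) * I i i"
    using has_bochner_integral_eq[OF m] by simp
  then have "I i i = m / CARD('n)" by simp
  then show ?thesis using hbi[of i j] off by auto
qed

lemma has_bochner_integral_Pair:
  assumes "has_bochner_integral M f a" "has_bochner_integral M g b"
  shows "has_bochner_integral M (\<lambda>x. (f x, g x)) (a, b)"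
proof -
  have "has_bochner_integral M (\<lambda>x. (f x, 0) + (0, g x)) ((a, 0) + (0, b))"
    by (intro has_bochner_integral_add
        has_bochner_integral_bounded_linear[OF _ assms(1), of "\<lambda>x. (x, 0)"]
        has_bochner_integral_bounded_linear[OF _ assms(2), of "\<lambda>x. (0, x)"]
        bounded_linear_Pair bounded_linear_ident bounded_linear_zero)
  then show ?thesis by simp
qed

lemma has_bochner_integral_vec:
  fixes f :: "'m \<Rightarrow> real ^ 'n"
  assumes "\<And>i. has_bochner_integral M (\<lambda>x. f x $ i) (a $ i)"
  shows "has_bochner_integral M f a"
proof -
  have "has_bochner_integral M (\<lambda>x. \<Sum>i\<in>UNIV. f x $ i *\<^sub>R axis i 1) (\<Sum>i\<in>UNIV. a $ i *\<^sub>R (axis i 1 :: real ^ 'n))"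
    by (intro has_bochner_integral_sum has_bochner_integral_scaleR_left assms)
  moreover have "(\<Sum>i\<in>UNIV. b $ i *\<^sub>R axis i 1) = b" for b :: "real ^ 'n"
    using basis_expansion[of b] by (simp add: scalar_mult_eq_scaleR)
  ultimately show ?thesis by simp
qed

section \<open>The Euler flux of a Maxwellian\<close>

text \<open>
  The moments in terms of the macroscopic variables. Expanding \<open>\<bar>v - u\<bar>\<^sup>2\<close> turns the definition of
  the temperature into a formula for the energy.
\<close>
lemma distribution_function_moments:
  assumes g: "distribution_function g"
  defines "\<rho> \<equiv> mass_density g" and "u \<equiv> bulk_velocity g" and "T \<equiv> temperature g"
  shows "has_bochner_integral lborel g \<rho>"
    and "has_bochner_integral lborel (\<lambda>v. g v *\<^sub>R v) (\<rho> *\<^sub>R u)"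
    and "has_bochner_integral lborel (\<lambda>v. (norm (v - u))\<^sup>2 * g v) (3 * \<rho> * T)"
    and "moments g = (\<rho>, \<rho> *\<^sub>R u, \<rho> * (norm u)\<^sup>2 / 2 + 3 / 2 * \<rho> * T)"
    and "\<rho> > 0" and "T \<ge> 0"
proof -
  from g have int: "has_bochner_integral lborel (\<lambda>v. g v *\<^sub>R phi v) (moments g)"
    and nonneg: "\<And>v. 0 \<le> g v" and pos: "\<rho> > 0"
    by (auto simp: distribution_function_def moments_def has_bochner_integral_iff \<rho>_def)
  show "\<rho> > 0" by fact
  obtain m E where mE: "moments g = (\<rho>, m, E)" by (cases "moments g") (simp add: \<rho>_def mass_density_def)
  have m: "m = \<rho> *\<^sub>R u"
    using pos by (simp add: u_def bulk_velocity_def mE flip: \<rho>_def)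
  show 0: "has_bochner_integral lborel g \<rho>"
    using has_bochner_integral_bounded_linear[OF bounded_linear_fst int] by (simp add: phi_def mE)
  note snd = has_bochner_integral_bounded_linear[OF bounded_linear_snd int]
  show 1: "has_bochner_integral lborel (\<lambda>v. g v *\<^sub>R v) (\<rho> *\<^sub>R u)"
    using has_bochner_integral_bounded_linear[OF bounded_linear_fst snd] by (simp add: phi_def mE m)
  have E: "has_bochner_integral lborel (\<lambda>v. g v * ((norm v)\<^sup>2 / 2)) E"
    using has_bochner_integral_bounded_linear[OF bounded_linear_snd snd] by (simp add: phi_def mE)
  have "has_bochner_integral lborel
      (\<lambda>v. 2 * (g v * ((norm v)\<^sup>2 / 2)) - 2 * ((g v *\<^sub>R v) \<bullet> u) + (norm u)\<^sup>2 * g v)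
      (2 * E - 2 * ((\<rho> *\<^sub>R u) \<bullet> u) + (norm u)\<^sup>2 * \<rho>)"
    by (intro has_bochner_integral_add has_bochner_integral_diff has_bochner_integral_mult_right
        has_bochner_integral_inner_left 0 1 E)
  moreover have "2 * (g v * ((norm v)\<^sup>2 / 2)) - 2 * ((g v *\<^sub>R v) \<bullet> u) + (norm u)\<^sup>2 * g v
      = (norm (v - u))\<^sup>2 * g v" for v
    by (simp add: power2_norm_eq_inner inner_diff inner_commute[of u v] algebra_simps)
  ultimately have 2: "has_bochner_integral lborel (\<lambda>v. (norm (v - u))\<^sup>2 * g v)
      (2 * E - 2 * ((\<rho> *\<^sub>R u) \<bullet> u) + (norm u)\<^sup>2 * \<rho>)" by simp
  then have T: "2 * E - 2 * ((\<rho> *\<^sub>R u) \<bullet> u) + (norm u)\<^sup>2 * \<rho> = 3 * \<rho> * T"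
    using pos by (simp add: T_def temperature_def has_bochner_integral_iff flip: u_def \<rho>_def)
  show "has_bochner_integral lborel (\<lambda>v. (norm (v - u))\<^sup>2 * g v) (3 * \<rho> * T)"
    using 2 unfolding T .
  show "moments g = (\<rho>, \<rho> *\<^sub>R u, \<rho> * (norm u)\<^sup>2 / 2 + 3 / 2 * \<rho> * T)"
    using T by (simp add: mE m power2_norm_eq_inner field_simps)
  show "T \<ge> 0"
    using pos nonneg by (auto simp: T_def temperature_def simp flip: \<rho>_def intro!: divide_nonneg_pos integral_nonneg)
qed

definition local_equilibrium :: "(vel \<Rightarrow> real) \<Rightarrow> bool" where
  "local_equilibrium g \<longleftrightarrow> distribution_function g \<and> g = maxwellian g"

text \<open>
  At zero temperature the formula of the Maxwellian, with \<open>0 powr (3 / 2) = 0\<close> and division by zero,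
  gives the zero function, which has no mass.
\<close>
lemma local_equilibrium_temperature_pos:
  assumes "local_equilibrium g"
  shows "temperature g > 0"
proof (rule ccontr)
  assume "\<not> temperature g > 0"
  moreover have D: "distribution_function g" and M: "g = maxwellian g"
    using assms by (auto simp: local_equilibrium_def)
  ultimately have "temperature g = 0"
    using distribution_function_moments(6)[OF D] by simp
  then have "maxwellian g = (\<lambda>v. 0)" by (simp add: maxwellian_def fun_eq_iff)
  with M have "g = (\<lambda>v. 0)" by simp
  then have "mass_density g = 0" by (simp add: mass_density_def moments_def)
  with distribution_function_moments(5)[OF D] show False by simp
qed

lemma euler_flux_moments:
  assumes g: "distribution_function g"
  defines "\<rho> \<equiv> mass_density g" and "u \<equiv> bulk_velocity g" and "T \<equiv> temperature g"
  shows "euler_flux (moments g) j = (\<rho> * u $ j, (\<rho> * u $ j) *\<^sub>R u + (\<rho> * T) *\<^sub>R axis j 1,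
    (\<rho> * (norm u)\<^sup>2 / 2 + 5 / 2 * \<rho> * T) * u $ j)"
proof -
  have "\<rho> > 0" using distribution_function_moments(5)[OF g] by (simp add: \<rho>_def)
  then have "pressure (moments g) = \<rho> * T"
    using distribution_function_moments(4)[OF g, folded \<rho>_def u_def T_def] by (simp add: pressure_def)
  then show ?thesis
    using \<open>\<rho> > 0\<close> distribution_function_moments(4)[OF g, folded \<rho>_def u_def T_def]
    by (simp add: euler_flux_def Let_def field_simps)
qed

lemma local_equilibrium_centered:
  assumes g: "local_equilibrium g"
  shows "g (bulk_velocity g + c) = mass_density g / (2 * pi * temperature g) powr (3 / 2)
       * exp (- (1 / (2 * temperature g)) * (norm c)\<^sup>2)"
proof -
  have "g (bulk_velocity g + c) = maxwellian g (bulk_velocity g + c)"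
    using g unfolding local_equilibrium_def by metis
  then show ?thesis by (simp add: maxwellian_def)
qed

text \<open>
  The closure of the moment hierarchy. In the peculiar velocity \<open>c = v - u\<close> the Maxwellian is a
  radial function \<open>G\<close> of \<open>c\<close>, so that the moments needed are \<open>\<langle>G\<rangle> = \<rho>\<close>, \<open>\<langle>c\<^sub>i G\<rangle> = 0\<close>,
  \<open>\<langle>c\<^sub>i c\<^sub>k G\<rangle> = \<rho> T \<delta>\<^sub>i\<^sub>k\<close> and \<open>\<langle>\<bar>c\<bar>\<^sup>2 c\<^sub>i G\<rangle> = 0\<close>. Mass and trace are the definitions of \<open>\<rho>\<close> and
  \<open>T\<close>, applied to \<open>g\<close> itself; the rest is symmetry.
\<close>
lemma local_equilibrium_flux:
  assumes g: "local_equilibrium g"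
  shows "has_bochner_integral lborel (\<lambda>v. g v *\<^sub>R (v $ j *\<^sub>R phi v)) (euler_flux (moments g) j)"
proof -
  define \<rho> u T where "\<rho> = mass_density g" and "u = bulk_velocity g" and "T = temperature g"
  define G where "G c = g (u + c)" for c
  have D: "distribution_function g" using g by (simp add: local_equilibrium_def)
  have T: "T > 0" unfolding T_def by (rule local_equilibrium_temperature_pos[OF g])
  define K a where "K = \<rho> / (2 * pi * T) powr (3 / 2)" and "a = 1 / (2 * T)"
  have G: "G c = K * exp (- a * (norm c)\<^sup>2)" for c
    using local_equilibrium_centered[OF g] by (simp add: G_def K_def a_def \<rho>_def u_def T_def)
  have a: "a > 0" using T by (simp add: a_def)
  have [measurable]: "G \<in> borel_measurable borel"
    unfolding G by measurable
  have int: "integrable lborel (\<lambda>c. (1 + norm c) ^ 3 * G c)"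
    using integrable_mult_right[OF integrable_power_mult_exp_neg_square[OF a, where 'a = vel and n = 3], of K]
    unfolding G by (simp add: mult_ac)
  have K: "K \<ge> 0" using distribution_function_moments(5)[OF D] by (simp add: K_def \<rho>_def)
  then have G_nonneg: "G c \<ge> 0" for c by (simp add: G)
  have m0: "has_bochner_integral lborel G \<rho>"
    using has_bochner_integral_lborel_translation[OF distribution_function_moments(1)[OF D], of u]
    by (simp add: G_def[abs_def] \<rho>_def)
  have trace: "has_bochner_integral lborel (\<lambda>c. (norm c)\<^sup>2 * G c) (3 * \<rho> * T)"
    using has_bochner_integral_lborel_translation[OF distribution_function_moments(3)[OF D], of u]
    by (simp add: G_def[abs_def] \<rho>_def u_def T_def)
  have m2: "has_bochner_integral lborel (\<lambda>c. c $ i * c $ k * G c) (if i = k then \<rho> * T else 0)" for i k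
  proof -
    have "G v = G w" if "norm v = norm w" for v w using that by (simp add: G)
    from has_bochner_integral_radial_second_moments[OF this _ trace, of i k]
    show ?thesis by (simp cong: if_cong)
  qed
  have m1: "has_bochner_integral lborel (\<lambda>c. c $ i * G c) 0" for i
  proof (rule has_bochner_integral_odd)
    show "integrable lborel (\<lambda>c. c $ i * G c)"
    proof (rule Bochner_Integration.integrable_bound[OF int])
      have "\<bar>c $ i\<bar> \<le> (1 + norm c) ^ 3" for c :: vel
      proof -
        have "\<bar>c $ i\<bar> \<le> 1 + norm c" using component_le_norm_cart[of c i] by simp
        also have "\<dots> \<le> (1 + norm c) ^ 3" by (rule self_le_power) auto
        finally show ?thesis .
      qed
      then show "AE c in lborel. norm (c $ i * G c) \<le> norm ((1 + norm c) ^ 3 * G c)"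
        using G_nonneg by (auto simp: abs_mult intro!: mult_right_mono)
    qed measurable
  qed (simp add: G)
  have m3: "has_bochner_integral lborel (\<lambda>c. (norm c)\<^sup>2 * c $ i * G c) 0" for i
  proof (rule has_bochner_integral_odd)
    show "integrable lborel (\<lambda>c. (norm c)\<^sup>2 * c $ i * G c)"
    proof (rule Bochner_Integration.integrable_bound[OF int])
      have "(norm c)\<^sup>2 * \<bar>c $ i\<bar> \<le> (1 + norm c) ^ 3" for c :: vel
      proof -
        have "(norm c)\<^sup>2 * \<bar>c $ i\<bar> \<le> (1 + norm c)\<^sup>2 * (1 + norm c)"
          using component_le_norm_cart[of c i] by (intro mult_mono power_mono) auto
        then show ?thesis by (simp add: power3_eq_cube power2_eq_square)
      qed
      then show "AE c in lborel. norm ((norm c)\<^sup>2 * c $ i * G c) \<le> norm ((1 + norm c) ^ 3 * G c)"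
        using G_nonneg by (auto simp: abs_mult intro!: mult_right_mono)
    qed measurable
  qed (simp add: G)
  have centred: "has_bochner_integral lborel q c"
    if "has_bochner_integral lborel (\<lambda>v. q (u + v)) c" for q :: "vel \<Rightarrow> real" and c
    using has_bochner_integral_lborel_translation[OF that, of "- u"] by simp
  have mass: "has_bochner_integral lborel (\<lambda>v. g v * v $ j) (\<rho> * u $ j)"
  proof (rule centred)
    have "has_bochner_integral lborel (\<lambda>c. u $ j * G c + c $ j * G c) (u $ j * \<rho> + 0)"
      by (intro has_bochner_integral_add has_bochner_integral_mult_right m0 m1)
    then show "has_bochner_integral lborel (\<lambda>c. g (u + c) * (u + c) $ j) (\<rho> * u $ j)"
      by (simp add: G_def algebra_simps)
  qed
  have mom: "has_bochner_integral lborel (\<lambda>v. g v * (v $ j * v $ i))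
      (((\<rho> * u $ j) *\<^sub>R u + (\<rho> * T) *\<^sub>R axis j 1) $ i)" for i
  proof (rule centred)
    have "has_bochner_integral lborel
        (\<lambda>c. u $ j * u $ i * G c + u $ j * (c $ i * G c) + u $ i * (c $ j * G c) + c $ j * c $ i * G c)
        (u $ j * u $ i * \<rho> + u $ j * 0 + u $ i * 0 + (if j = i then \<rho> * T else 0))"
      by (intro has_bochner_integral_add has_bochner_integral_mult_right m0 m1 m2)
    moreover have "u $ j * u $ i * G c + u $ j * (c $ i * G c) + u $ i * (c $ j * G c) + c $ j * c $ i * G c
        = g (u + c) * ((u + c) $ j * (u + c) $ i)" for c
      by (simp add: G_def algebra_simps)
    moreover have "u $ j * u $ i * \<rho> + u $ j * 0 + u $ i * 0 + (if j = i then \<rho> * T else 0)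
        = ((\<rho> * u $ j) *\<^sub>R u + (\<rho> * T) *\<^sub>R axis j 1) $ i"
      by (auto simp: axis_def)
    ultimately show "has_bochner_integral lborel (\<lambda>c. g (u + c) * ((u + c) $ j * (u + c) $ i))
        (((\<rho> * u $ j) *\<^sub>R u + (\<rho> * T) *\<^sub>R axis j 1) $ i)" by (simp only:)
  qed
  have energy: "has_bochner_integral lborel (\<lambda>v. g v * (v $ j * ((norm v)\<^sup>2 / 2)))
      ((\<rho> * (norm u)\<^sup>2 / 2 + 5 / 2 * \<rho> * T) * u $ j)"
  proof (rule centred)
    have "has_bochner_integral lborel
        (\<lambda>c. ((norm u)\<^sup>2 * u $ j * G c + (norm u)\<^sup>2 * (c $ j * G c)
            + 2 * u $ j * (\<Sum>i\<in>UNIV. u $ i * (c $ i * G c))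
            + 2 * (\<Sum>i\<in>UNIV. u $ i * (c $ i * c $ j * G c))
            + u $ j * ((norm c)\<^sup>2 * G c) + (norm c)\<^sup>2 * c $ j * G c) / 2)
        (((norm u)\<^sup>2 * u $ j * \<rho> + (norm u)\<^sup>2 * 0
            + 2 * u $ j * (\<Sum>i\<in>UNIV. u $ i * 0)
            + 2 * (\<Sum>i\<in>UNIV. u $ i * (if i = j then \<rho> * T else 0))
            + u $ j * (3 * \<rho> * T) + 0) / 2)"
      by (intro has_bochner_integral_divide_zero has_bochner_integral_add has_bochner_integral_sum
          has_bochner_integral_mult_right m0 m1 m2 m3 trace)
    moreover have "((norm u)\<^sup>2 * u $ j * G c + (norm u)\<^sup>2 * (c $ j * G c)
            + 2 * u $ j * (\<Sum>i\<in>UNIV. u $ i * (c $ i * G c))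
            + 2 * (\<Sum>i\<in>UNIV. u $ i * (c $ i * c $ j * G c))
            + u $ j * ((norm c)\<^sup>2 * G c) + (norm c)\<^sup>2 * c $ j * G c) / 2
        = g (u + c) * ((u + c) $ j * ((norm (u + c))\<^sup>2 / 2))" for c
    proof -
      have "(norm (u + c))\<^sup>2 = (norm u)\<^sup>2 + 2 * (u \<bullet> c) + (norm c)\<^sup>2"
        by (simp add: power2_norm_eq_inner inner_add inner_commute[of c u])
      moreover have "(\<Sum>i\<in>UNIV. u $ i * (c $ i * G c)) = (u \<bullet> c) * G c"
        by (simp add: inner_vec_def sum_distrib_right mult.assoc)
      moreover have "(\<Sum>i\<in>UNIV. u $ i * (c $ i * c $ j * G c)) = (u \<bullet> c) * (c $ j * G c)"
        by (simp add: inner_vec_def sum_distrib_right mult.assoc)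
      ultimately show ?thesis unfolding G_def[symmetric] by (simp add: algebra_simps)
    qed
    moreover have "((norm u)\<^sup>2 * u $ j * \<rho> + (norm u)\<^sup>2 * 0
            + 2 * u $ j * (\<Sum>i\<in>UNIV. u $ i * 0)
            + 2 * (\<Sum>i\<in>UNIV. u $ i * (if i = j then \<rho> * T else 0))
            + u $ j * (3 * \<rho> * T) + 0) / 2
        = (\<rho> * (norm u)\<^sup>2 / 2 + 5 / 2 * \<rho> * T) * u $ j"
      by (simp add: if_distrib cong: if_cong) (simp add: algebra_simps)
    ultimately show "has_bochner_integral lborel (\<lambda>c. g (u + c) * ((u + c) $ j * ((norm (u + c))\<^sup>2 / 2)))
        ((\<rho> * (norm u)\<^sup>2 / 2 + 5 / 2 * \<rho> * T) * u $ j)" by simp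
  qed
  have "has_bochner_integral lborel (\<lambda>v. (g v * v $ j, (g v * v $ j) *\<^sub>R v, g v * (v $ j * ((norm v)\<^sup>2 / 2))))
      (euler_flux (moments g) j)"
    unfolding euler_flux_moments[OF D, folded \<rho>_def u_def T_def]
    by (intro has_bochner_integral_Pair has_bochner_integral_vec mass energy)
      (use mom in \<open>simp add: mult.assoc\<close>)
  then show ?thesis by (simp add: phi_def mult.assoc)
qed

section \<open>Smooth families of Maxwellians\<close>

lemma differentiable_imp_eventually_Lipschitz_at:
  fixes f :: "'a::real_normed_vector \<Rightarrow> 'b::real_normed_vector"
  assumes "f differentiable (at x)"
  shows "\<exists>C\<ge>0. eventually (\<lambda>y. norm (f y - f x) \<le> C * norm (y - x)) (at x)"
proof -
  from assms obtain f' where f': "(f has_derivative f') (at x)"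
    by (auto simp: differentiable_def)
  then obtain K where K: "K > 0" "\<And>h. norm (f' h) \<le> norm h * K"
    using has_derivative_bounded_linear bounded_linear.pos_bounded by blast
  obtain d where d: "d > 0" "\<And>y. norm (y - x) < d \<Longrightarrow> norm (f y - f x - f' (y - x)) \<le> 1 * norm (y - x)"
    using f' unfolding has_derivative_at_alt by (metis zero_less_one)
  have "norm (f y - f x) \<le> (K + 1) * norm (y - x)" if "norm (y - x) < d" for y
  proof -
    have "norm (f y - f x) \<le> norm (f y - f x - f' (y - x)) + norm (f' (y - x))"
      by (metis diff_add_cancel norm_triangle_ineq)
    also have "\<dots> \<le> 1 * norm (y - x) + norm (y - x) * K"
      using that d K by (intro add_mono) auto
    finally show ?thesis by (simp add: algebra_simps)
  qed
  then have "eventually (\<lambda>y. norm (f y - f x) \<le> (K + 1) * norm (y - x)) (at x)"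
    using d(1) by (auto simp: eventually_at dist_norm)
  with K show ?thesis by (intro exI[of _ "K + 1"]) auto
qed

text \<open>
  A Maxwellian is determined by the coefficients of its logarithm, a quadratic polynomial in the
  velocity. In contrast to \<open>\<rho>\<close>, \<open>u\<close> and \<open>T\<close>, these coefficients are linear in the logarithms of
  point values.
\<close>
lemma local_equilibrium_exponential:
  assumes g: "local_equilibrium g"
  shows "0 < g v"
    and "ln (g v) = ln (g 0) + (bulk_velocity g /\<^sub>R temperature g) \<bullet> v
      - 1 / (2 * temperature g) * (norm v)\<^sup>2"
proof -
  define u T where "u = bulk_velocity g" and "T = temperature g"
  define K where "K = mass_density g / (2 * pi * T) powr (3 / 2)"
  have T: "T > 0" unfolding T_def by (rule local_equilibrium_temperature_pos[OF g])
  have "K > 0"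
    using T distribution_function_moments(5)[of g] g by (simp add: K_def local_equilibrium_def)
  have form: "g v = K * exp (- (1 / (2 * T)) * (norm (v - u))\<^sup>2)" for v
    using local_equilibrium_centered[OF g, of "v - u"] by (simp add: K_def u_def T_def)
  then show "0 < g v" using \<open>K > 0\<close> by simp
  have ln: "ln (g v) = ln K - (1 / (2 * T)) * (norm (v - u))\<^sup>2" for v
    using \<open>K > 0\<close> by (simp add: form ln_mult)
  have sq: "(norm (v - u))\<^sup>2 = (norm v)\<^sup>2 - 2 * (u \<bullet> v) + (norm u)\<^sup>2"
    by (simp add: power2_norm_eq_inner inner_diff inner_commute[of v u])
  then show "ln (g v) = ln (g 0) + (bulk_velocity g /\<^sub>R temperature g) \<bullet> v
      - 1 / (2 * temperature g) * (norm v)\<^sup>2"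
    unfolding u_def[symmetric] T_def[symmetric] ln[of v] ln[of 0] sq using T by (simp add: field_simps)
qed

lemma abs_exp_diff_le:
  fixes s t m :: real
  assumes "s \<le> m" "t \<le> m"
  shows "\<bar>exp s - exp t\<bar> \<le> exp m * \<bar>s - t\<bar>"
proof -
  have *: "exp s - exp t \<le> exp m * (s - t)" if "t \<le> s" "s \<le> m" for s t
  proof -
    have "exp s - exp t = exp s * (1 - exp (t - s))"
      by (simp add: exp_diff right_diff_distrib)
    also have "\<dots> \<le> exp m * (s - t)"
    proof (rule mult_mono)
      show "1 - exp (t - s) \<le> s - t"
        using exp_ge_add_one_self[of "t - s"] by linarith
    qed (use that in auto)
    finally show ?thesis .
  qed
  show ?thesis
    using *[of t s] *[of s t] assms by (cases "t \<le> s") (auto simp: abs_if)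
qed

text \<open>
  Coefficients that are differentiable at \<open>x\<close> are Lipschitz from \<open>x\<close>, and near \<open>x\<close> the
  coefficient \<open>\<gamma>\<close> stays above half of its value at \<open>x\<close>. Completing the square absorbs the linear
  term into another quarter, which leaves Gaussian decay with constant \<open>\<gamma> x / 4\<close>, uniformly in \<open>y\<close>.
\<close>
lemma exp_quadratic_Lipschitz_bound:
  fixes A :: "'a::real_normed_vector \<Rightarrow> real" and \<beta> :: "'a \<Rightarrow> 'b::real_inner" and \<gamma> :: "'a \<Rightarrow> real"
  assumes A: "A differentiable (at x)" and \<beta>: "\<beta> differentiable (at x)"
    and \<gamma>: "\<gamma> differentiable (at x)" and pos: "\<gamma> x > 0"
  shows "\<exists>C a. a > 0 \<and> eventually (\<lambda>y. \<forall>v.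
      \<bar>exp (A y + \<beta> y \<bullet> v - \<gamma> y * (norm v)\<^sup>2) - exp (A x + \<beta> x \<bullet> v - \<gamma> x * (norm v)\<^sup>2)\<bar>
        \<le> C * ((1 + norm v)\<^sup>2 * exp (- a * (norm v)\<^sup>2)) * norm (y - x)) (at x)"
proof -
  define S where "S y v = A y + \<beta> y \<bullet> v - \<gamma> y * (norm v)\<^sup>2" for y v
  define a b where "a = \<gamma> x / 4" and "b = norm (\<beta> x) + 1"
  define K where "K = A x + 1 + b\<^sup>2 / (4 * a)"
  have a: "a > 0" using pos by (simp add: a_def)
  have S_le: "S y v \<le> K - a * (norm v)\<^sup>2"
    if "A y < A x + 1" "norm (\<beta> y) < b" "2 * a < \<gamma> y" for y v
  proof -
    have "\<beta> y \<bullet> v \<le> b * norm v"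
      using norm_cauchy_schwarz[of "\<beta> y" v] that(2)
      by (meson less_imp_le mult_right_mono norm_ge_zero order_trans)
    moreover have "2 * a * (norm v)\<^sup>2 \<le> \<gamma> y * (norm v)\<^sup>2"
      using that(3) by (intro mult_right_mono) auto
    moreover have "b * norm v \<le> a * (norm v)\<^sup>2 + b\<^sup>2 / (4 * a)"
    proof -
      have "0 \<le> (2 * a * norm v - b)\<^sup>2 / (4 * a)" using a by simp
      also have "\<dots> = a * (norm v)\<^sup>2 + b\<^sup>2 / (4 * a) - b * norm v"
        using a by (simp add: field_simps power2_eq_square)
      finally show ?thesis by simp
    qed
    ultimately show ?thesis using that(1) by (simp add: S_def K_def)
  qed
  have tendsto: "(A \<longlongrightarrow> A x) (at x)" "(\<beta> \<longlongrightarrow> \<beta> x) (at x)" "(\<gamma> \<longlongrightarrow> \<gamma> x) (at x)"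
    using A \<beta> \<gamma> differentiable_imp_continuous_within continuous_within by blast+
  have ev: "eventually (\<lambda>y. A y < A x + 1) (at x)" "eventually (\<lambda>y. norm (\<beta> y) < b) (at x)"
    "eventually (\<lambda>y. 2 * a < \<gamma> y) (at x)"
    using order_tendstoD(2)[OF tendsto(1), of "A x + 1"]
      order_tendstoD(2)[OF tendsto_norm[OF tendsto(2)], of b]
      order_tendstoD(1)[OF tendsto(3), of "2 * a"] pos by (auto simp: a_def b_def)
  have S_x: "S x v \<le> K - a * (norm v)\<^sup>2" for v
    by (rule S_le) (use pos in \<open>auto simp: a_def b_def\<close>)
  from differentiable_imp_eventually_Lipschitz_at[OF A] obtain C1 where C1: "C1 \<ge> 0"
    "eventually (\<lambda>y. norm (A y - A x) \<le> C1 * norm (y - x)) (at x)" by auto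
  from differentiable_imp_eventually_Lipschitz_at[OF \<beta>] obtain C2 where C2: "C2 \<ge> 0"
    "eventually (\<lambda>y. norm (\<beta> y - \<beta> x) \<le> C2 * norm (y - x)) (at x)" by auto
  from differentiable_imp_eventually_Lipschitz_at[OF \<gamma>] obtain C3 where C3: "C3 \<ge> 0"
    "eventually (\<lambda>y. norm (\<gamma> y - \<gamma> x) \<le> C3 * norm (y - x)) (at x)" by auto
  define L where "L = C1 + C2 + C3"
  have "eventually (\<lambda>y. \<forall>v. \<bar>exp (S y v) - exp (S x v)\<bar>
      \<le> (L * exp K) * ((1 + norm v)\<^sup>2 * exp (- a * (norm v)\<^sup>2)) * norm (y - x)) (at x)"
    using ev C1(2) C2(2) C3(2)
  proof eventually_elim
    case (elim y)
    show ?case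
    proof
      fix v :: 'b
      define r where "r = norm v"
      have r: "r \<ge> 0" by (simp add: r_def)
      have "S y v - S x v = (A y - A x) + (\<beta> y - \<beta> x) \<bullet> v - (\<gamma> y - \<gamma> x) * r\<^sup>2"
        by (simp add: S_def r_def inner_diff_left algebra_simps)
      also have "\<bar>\<dots>\<bar> \<le> \<bar>A y - A x\<bar> + \<bar>(\<beta> y - \<beta> x) \<bullet> v\<bar> + \<bar>\<gamma> y - \<gamma> x\<bar> * r\<^sup>2"
        using abs_mult[of "\<gamma> y - \<gamma> x" "r\<^sup>2"] by simp
      also have "\<dots> \<le> C1 * norm (y - x) * (1 + r)\<^sup>2 + C2 * norm (y - x) * (1 + r)\<^sup>2
          + C3 * norm (y - x) * (1 + r)\<^sup>2"
      proof (intro add_mono)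
        have one: "1 \<le> (1 + r)\<^sup>2" using r by (intro one_le_power) simp
        have rle: "r \<le> (1 + r)\<^sup>2" using r by (simp add: power2_eq_square algebra_simps)
        have r2: "r\<^sup>2 \<le> (1 + r)\<^sup>2" using r by (intro power_mono) auto
        show "\<bar>A y - A x\<bar> \<le> C1 * norm (y - x) * (1 + r)\<^sup>2"
          using mult_mono[OF elim(4) one] C1(1) by simp
        have "\<bar>(\<beta> y - \<beta> x) \<bullet> v\<bar> \<le> norm (\<beta> y - \<beta> x) * r"
          unfolding r_def by (rule Cauchy_Schwarz_ineq2)
        also have "\<dots> \<le> C2 * norm (y - x) * (1 + r)\<^sup>2"
          by (rule mult_mono[OF elim(5) rle]) (use C2(1) r in auto)
        finally show "\<bar>(\<beta> y - \<beta> x) \<bullet> v\<bar> \<le> C2 * norm (y - x) * (1 + r)\<^sup>2" .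
        show "\<bar>\<gamma> y - \<gamma> x\<bar> * r\<^sup>2 \<le> C3 * norm (y - x) * (1 + r)\<^sup>2"
          using mult_mono[OF elim(6) r2] C3(1) by simp
      qed
      also have "\<dots> = L * (1 + r)\<^sup>2 * norm (y - x)" by (simp add: L_def algebra_simps)
      finally have "\<bar>S y v - S x v\<bar> \<le> L * (1 + r)\<^sup>2 * norm (y - x)" .
      moreover have "\<bar>exp (S y v) - exp (S x v)\<bar> \<le> exp (K - a * r\<^sup>2) * \<bar>S y v - S x v\<bar>"
        unfolding r_def by (intro abs_exp_diff_le S_x S_le elim)
      ultimately have "\<bar>exp (S y v) - exp (S x v)\<bar> \<le> exp (K - a * r\<^sup>2) * (L * (1 + r)\<^sup>2 * norm (y - x))"
        by (meson exp_ge_zero mult_left_mono order_trans)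
      also have "exp (K - a * r\<^sup>2) = exp K * exp (- a * r\<^sup>2)" by (simp add: exp_diff exp_minus divide_inverse)
      finally show "\<bar>exp (S y v) - exp (S x v)\<bar>
        \<le> (L * exp K) * ((1 + norm v)\<^sup>2 * exp (- a * (norm v)\<^sup>2)) * norm (y - x)"
        by (simp add: r_def mult_ac)
    qed
  qed
  then show ?thesis using a unfolding S_def by blast
qed

lemma differentiable_ln:
  fixes f :: "'a::real_normed_vector \<Rightarrow> real"
  assumes "f differentiable (at x)" "f x > 0"
  shows "(\<lambda>y. ln (f y)) differentiable (at x)"
  using assms has_derivative_ln unfolding differentiable_def by blast

text \<open>
  The logarithms of \<open>g\<close> at the velocities \<open>0\<close> and \<open>\<plusminus>e\<^sub>i\<close> determine the quadratic polynomial
  \<open>ln g\<close>: odd parts give the linear coefficient, even parts the quadratic one. So differentiability in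
  \<open>y\<close> at these seven velocities controls all others at once.
\<close>
lemma local_equilibrium_family_Lipschitz_bound:
  fixes g :: "'a::real_normed_vector \<Rightarrow> vel \<Rightarrow> real"
  assumes \<Omega>: "open \<Omega>" "x \<in> \<Omega>" and eq: "\<And>y. y \<in> \<Omega> \<Longrightarrow> local_equilibrium (g y)"
    and diff: "\<And>v. (\<lambda>y. g y v) differentiable (at x)"
  shows "\<exists>C a. a > 0 \<and> eventually (\<lambda>y. \<forall>v. \<bar>g y v - g x v\<bar>
      \<le> C * ((1 + norm v)\<^sup>2 * exp (- a * (norm v)\<^sup>2)) * norm (y - x)) (at x)"
proof -
  define e :: "3 \<Rightarrow> vel" where "e i = axis i 1" for i
  define A where "A y = ln (g y 0)" for y
  define \<beta> where "\<beta> y = (\<Sum>i\<in>UNIV. ((ln (g y (e i)) - ln (g y (- e i))) / 2) *\<^sub>R e i)" for y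
  define \<gamma> where "\<gamma> y = ln (g y 0) - (ln (g y (e 1)) + ln (g y (- e 1))) / 2" for y
  have norm_e: "norm (e i) = 1" for i by (simp add: e_def)
  have \<beta>_eq: "\<beta> y = bulk_velocity (g y) /\<^sub>R temperature (g y)"
    and \<gamma>_eq: "\<gamma> y = 1 / (2 * temperature (g y))" if "y \<in> \<Omega>" for y
  proof -
    note ln = local_equilibrium_exponential(2)[OF eq[OF that]]
    have "(ln (g y (e i)) - ln (g y (- e i))) / 2 = (bulk_velocity (g y) /\<^sub>R temperature (g y)) $ i" for i
      using ln[of "e i"] ln[of "- e i"] by (simp add: norm_e) (simp add: e_def inner_axis)
    then have "\<beta> y $ j = (bulk_velocity (g y) /\<^sub>R temperature (g y)) $ j" for j
      by (simp add: \<beta>_def e_def axis_def if_distrib cong: if_cong)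
    then show "\<beta> y = bulk_velocity (g y) /\<^sub>R temperature (g y)" by (simp add: vec_eq_iff)
    show "\<gamma> y = 1 / (2 * temperature (g y))"
      unfolding \<gamma>_def using ln[of "e 1"] ln[of "- e 1"] by (simp add: norm_e diff_divide_distrib)
  qed
  have form: "g y v = exp (A y + \<beta> y \<bullet> v - \<gamma> y * (norm v)\<^sup>2)" if "y \<in> \<Omega>" for y v
    using local_equilibrium_exponential[OF eq[OF that], of v]
    unfolding A_def \<beta>_eq[OF that] \<gamma>_eq[OF that] by (metis exp_ln)
  have dln: "(\<lambda>y. ln (g y v)) differentiable (at x)" for v
    by (rule differentiable_ln[OF diff]) (rule local_equilibrium_exponential(1)[OF eq[OF \<Omega>(2)]])
  have "\<gamma> x > 0"
    using \<gamma>_eq[OF \<Omega>(2)] local_equilibrium_temperature_pos[OF eq[OF \<Omega>(2)]] by simp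
  moreover have "A differentiable (at x)" unfolding A_def by (rule dln)
  moreover have "\<beta> differentiable (at x)"
    unfolding \<beta>_def by (intro differentiable_sum ballI differentiable_scaleR differentiable_divide
        differentiable_diff dln differentiable_const finite) auto
  moreover have "\<gamma> differentiable (at x)"
    unfolding \<gamma>_def by (intro differentiable_diff differentiable_divide differentiable_add dln differentiable_const) auto
  ultimately obtain C a where a: "a > 0" and ev: "eventually (\<lambda>y. \<forall>v.
      \<bar>exp (A y + \<beta> y \<bullet> v - \<gamma> y * (norm v)\<^sup>2) - exp (A x + \<beta> x \<bullet> v - \<gamma> x * (norm v)\<^sup>2)\<bar>
        \<le> C * ((1 + norm v)\<^sup>2 * exp (- a * (norm v)\<^sup>2)) * norm (y - x)) (at x)"
    using exp_quadratic_Lipschitz_bound[of A x \<beta> \<gamma>] by blast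
  have "eventually (\<lambda>y. y \<in> \<Omega>) (at x)"
    using \<Omega> by (rule eventually_at_in_open')
  with ev have "eventually (\<lambda>y. \<forall>v. \<bar>g y v - g x v\<bar>
      \<le> C * ((1 + norm v)\<^sup>2 * exp (- a * (norm v)\<^sup>2)) * norm (y - x)) (at x)"
    by eventually_elim (simp add: form[OF \<Omega>(2)] form)
  with a show ?thesis by blast
qed

lemma norm_phi_le: "norm (phi v) \<le> (1 + norm v)\<^sup>2"
proof -
  have "norm (phi v) \<le> norm (1::real) + (norm v + norm ((norm v)\<^sup>2 / 2))"
    unfolding phi_def by (meson add_left_mono norm_Pair_le order_trans)
  also have "\<dots> \<le> (1 + norm v)\<^sup>2" by (simp add: power2_eq_square algebra_simps)
  finally show ?thesis .
qed

lemma borel_measurable_phi [measurable]: "phi \<in> borel_measurable borel"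
  unfolding phi_def[abs_def]
  by (intro borel_measurable_continuous_onI continuous_intros) auto

text \<open>
  The flux as an integral over the velocity, differentiated under the integral sign. The weight
  \<open>v\<^sub>j \<phi>(v)\<close> grows cubically and the increments of \<open>g\<close> are a quadratic factor times a Gaussian,
  so the dominating function is a fifth power times a Gaussian.
\<close>
lemma local_equilibrium_flux_has_derivative:
  fixes g :: "'a::real_normed_vector \<Rightarrow> vel \<Rightarrow> real"
  assumes \<Omega>: "open \<Omega>" "x \<in> \<Omega>" and eq: "\<And>y. y \<in> \<Omega> \<Longrightarrow> local_equilibrium (g y)"
    and diff: "\<And>v. (\<lambda>y. g y v) differentiable (at x)"
  defines "D \<equiv> \<lambda>v. frechet_derivative (\<lambda>y. g y v) (at x)"
  shows "integrable lborel (\<lambda>v. D v h *\<^sub>R (v $ j *\<^sub>R phi v))"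
    and "((\<lambda>y. euler_flux (moments (g y)) j) has_derivative
      (\<lambda>h. LINT v|lborel. D v h *\<^sub>R (v $ j *\<^sub>R phi v))) (at x)"
proof -
  from local_equilibrium_family_Lipschitz_bound[OF \<Omega> eq diff] obtain C a where a: "a > 0"
    and bound: "eventually (\<lambda>y. \<forall>v. \<bar>g y v - g x v\<bar>
      \<le> C * ((1 + norm v)\<^sup>2 * exp (- a * (norm v)\<^sup>2)) * norm (y - x)) (at x)" by blast
  define w where "w v = C * ((1 + norm v) ^ 5 * exp (- a * (norm v)\<^sup>2))" for v :: vel
  have w: "integrable lborel w"
    unfolding w_def by (intro integrable_mult_right integrable_power_mult_exp_neg_square a)
  have weight: "norm (v $ j *\<^sub>R phi v) \<le> (1 + norm v) ^ 3" for v :: vel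
  proof -
    have "norm (v $ j *\<^sub>R phi v) \<le> (1 + norm v) * (1 + norm v)\<^sup>2"
      using component_le_norm_cart[of v j] norm_phi_le[of v]
      by (simp only: norm_scaleR) (intro mult_mono, auto)
    then show ?thesis by (simp add: power3_eq_cube power2_eq_square)
  qed
  have deriv: "((\<lambda>y. g y v *\<^sub>R (v $ j *\<^sub>R phi v)) has_derivative
      (\<lambda>h. D v h *\<^sub>R (v $ j *\<^sub>R phi v))) (at x)" for v
    unfolding D_def using diff[of v] by (intro has_derivative_scaleR_left) (simp add: frechet_derivative_works)
  have int: "integrable lborel (\<lambda>v. g y v *\<^sub>R (v $ j *\<^sub>R phi v))" if "y \<in> \<Omega>" for y
    using local_equilibrium_flux[OF eq[OF that]] by (simp add: has_bochner_integral_iff)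
  have in_\<Omega>: "eventually (\<lambda>y. y \<in> \<Omega>) (at x)"
    using \<Omega> by (rule eventually_at_in_open')
  have int_y: "eventually (\<lambda>y. integrable lborel (\<lambda>v. g y v *\<^sub>R (v $ j *\<^sub>R phi v))) (at x)"
    using in_\<Omega> by eventually_elim (rule int)
  have "eventually (\<lambda>y. \<forall>v. norm (g y v *\<^sub>R (v $ j *\<^sub>R phi v) - g x v *\<^sub>R (v $ j *\<^sub>R phi v))
      \<le> w v * norm (y - x)) (at x)"
    using bound
  proof eventually_elim
    case (elim y)
    show ?case
    proof
      fix v
      have "norm (g y v *\<^sub>R (v $ j *\<^sub>R phi v) - g x v *\<^sub>R (v $ j *\<^sub>R phi v))
          = \<bar>g y v - g x v\<bar> * norm (v $ j *\<^sub>R phi v)"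
        by (metis norm_scaleR scaleR_left_diff_distrib)
      also have "\<dots> \<le> (C * ((1 + norm v)\<^sup>2 * exp (- a * (norm v)\<^sup>2)) * norm (y - x)) * (1 + norm v) ^ 3"
        using elim weight by (intro mult_mono) (auto intro: order_trans[OF abs_ge_zero])
      also have "\<dots> = C * ((1 + norm v) ^ (2 + 3) * exp (- a * (norm v)\<^sup>2)) * norm (y - x)"
        by (simp only: power_add mult_ac)
      finally show "norm (g y v *\<^sub>R (v $ j *\<^sub>R phi v) - g x v *\<^sub>R (v $ j *\<^sub>R phi v))
          \<le> w v * norm (y - x)" by (simp add: w_def)
    qed
  qed
  note main = has_derivative_integral_dominated[OF deriv int[OF \<Omega>(2)] int_y this w]
  show "integrable lborel (\<lambda>v. D v h *\<^sub>R (v $ j *\<^sub>R phi v))" by (rule main(1))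
  show "((\<lambda>y. euler_flux (moments (g y)) j) has_derivative
      (\<lambda>h. LINT v|lborel. D v h *\<^sub>R (v $ j *\<^sub>R phi v))) (at x)"
  proof (rule has_derivative_transform_within_open[OF main(2) \<Omega>])
    show "(LINT v|lborel. g y v *\<^sub>R (v $ j *\<^sub>R phi v)) = euler_flux (moments (g y)) j" if "y \<in> \<Omega>" for y
      using local_equilibrium_flux[OF eq[OF that]] by (simp add: has_bochner_integral_iff)
  qed
qed

text \<open>
  Both sides are the sum over \<open>k\<close> of \<open>-\<langle>\<partial>\<^sub>k g v\<^bsub>\<iota> k\<^esub> \<phi>\<rangle>\<close>: on the left by linearity of the integral,
  on the right because the derivative of the Euler flux may be taken under the integral.
\<close>
lemma moments_transport_local_equilibrium:
  fixes g :: "real ^ 'd \<Rightarrow> vel \<Rightarrow> real"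
  assumes \<Omega>: "open \<Omega>" "x \<in> \<Omega>" and eq: "\<And>y. y \<in> \<Omega> \<Longrightarrow> local_equilibrium (g y)"
    and diff: "\<And>v. (\<lambda>y. g y v) differentiable (at x)"
  shows "moments (transport \<iota> g x) = - div_euler_flux \<iota> (\<lambda>y. moments (g y)) x"
proof -
  note D = local_equilibrium_flux_has_derivative[OF assms]
  have "frechet_derivative (\<lambda>y. euler_flux (moments (g y)) j) (at x) =
      (\<lambda>h. LINT v|lborel. frechet_derivative (\<lambda>y. g y v) (at x) h *\<^sub>R (v $ j *\<^sub>R phi v))" for j
    by (rule frechet_derivative_at[OF D(2), symmetric])
  then have "partial_x k (\<lambda>y. euler_flux (moments (g y)) (\<iota> k)) x
     = (LINT v|lborel. partial_x k (\<lambda>y. g y v) x *\<^sub>R (v $ \<iota> k *\<^sub>R phi v))" for k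
    by (simp add: partial_x_def)
  then have "- div_euler_flux \<iota> (\<lambda>y. moments (g y)) x
     = - (\<Sum>k\<in>UNIV. LINT v|lborel. partial_x k (\<lambda>y. g y v) x *\<^sub>R (v $ \<iota> k *\<^sub>R phi v))"
    by (simp add: div_euler_flux_def)
  also have "\<dots> = (LINT v|lborel. - (\<Sum>k\<in>UNIV. partial_x k (\<lambda>y. g y v) x *\<^sub>R (v $ \<iota> k *\<^sub>R phi v)))"
    using D(1) by (simp add: partial_x_def)
  also have "\<dots> = moments (transport \<iota> g x)"
    unfolding moments_def transport_def
    by (intro Bochner_Integration.integral_cong refl) (simp add: scaleR_sum_left mult.commute)
  finally show ?thesis by simp
qed

section \<open>The scheme and its limit\<close>

lemma matrix_inv_left:
  assumes "invertible A"
  shows "matrix_inv A ** A = mat 1"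
proof -
  from assms have "\<exists>A'. A ** A' = mat 1 \<and> A' ** A = mat 1" by (simp add: invertible_def)
  from someI_ex[OF this] show ?thesis by (simp add: matrix_inv_def)
qed

lemma imex_step_stage:
  assumes "imex_step \<iota> \<Omega> GP QP At wt A w dt \<epsilon> f F f'" "x \<in> \<Omega>"
  shows "F i x v = f x v
      + dt * (\<Sum>j\<in>UNIV. At $ i $ j * (1 / \<epsilon> * GP (F j x) v + transport \<iota> (F j) x v))
      + dt / \<epsilon> * (\<Sum>j\<in>UNIV. A $ i $ j * QP (F j x) v)"
proof -
  have "F i x v = f x v
      + dt * (At *v (\<chi> j. 1 / \<epsilon> * GP (F j x) v + transport \<iota> (F j) x v)) $ i
      + dt / \<epsilon> * (A *v (\<chi> j. QP (F j x) v)) $ i"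
    using assms unfolding imex_step_def Let_def by blast
  then show ?thesis by (simp only: matrix_vector_mult_def vec_lambda_beta)
qed

text \<open>
  Applying the row vector \<open>c = w v* matrix_inv A\<close> to the stage equations produces the explicit part with
  weights \<open>c v* At = wt\<close> and the implicit part with weights \<open>c v* A = w\<close>, which is exactly the
  increment of the update. The terms of order \<open>1/\<epsilon>\<close> thus disappear from the update.
\<close>
lemma imex_step_update_from_stages:
  assumes step: "imex_step \<iota> \<Omega> GP QP At wt A w dt \<epsilon> f F f'" and x: "x \<in> \<Omega>"
    and A: "invertible A" and wt: "wt = w v* (matrix_inv A ** At)"
  shows "f' x v = f x v + (\<Sum>i\<in>UNIV. (w v* matrix_inv A) $ i * (F i x v - f x v))"
proof -
  define c where "c = w v* matrix_inv A"
  define ex where "ex = (\<chi> j. 1 / \<epsilon> * GP (F j x) v + transport \<iota> (F j) x v)"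
  define im where "im = (\<chi> j. QP (F j x) v)"
  have stage: "(\<chi> i. F i x v - f x v) = dt *\<^sub>R (At *v ex) + (dt / \<epsilon>) *\<^sub>R (A *v im)"
    and update: "f' x v = f x v + dt * (wt \<bullet> ex) + dt / \<epsilon> * (w \<bullet> im)"
    using step x by (simp_all add: imex_step_def Let_def vec_eq_iff ex_def im_def)
  have "c v* At = wt" by (simp add: c_def wt vector_matrix_mul_assoc)
  moreover have "c v* A = w"
    by (simp add: c_def vector_matrix_mul_assoc matrix_inv_left[OF A])
  ultimately have "c \<bullet> (\<chi> i. F i x v - f x v) = dt * (wt \<bullet> ex) + dt / \<epsilon> * (w \<bullet> im)"
    by (simp add: stage inner_add_right flip: dot_lmul_matrix)
  moreover have "c \<bullet> (\<chi> i. F i x v - f x v) = (\<Sum>i\<in>UNIV. c $ i * (F i x v - f x v))"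
    by (simp add: inner_vec_def)
  ultimately show ?thesis using update by (simp add: c_def)
qed

text \<open>
  Solving the limiting stage equations by forward substitution. Here \<open>q\<close> stands for the
  penalization and \<open>p\<close> for the penalized collision operator at the stages; \<open>transfer\<close> holds because the
  full collision operator and its penalization have the same equilibria.
\<close>
lemma lower_triangular_cascade:
  fixes A At :: "real ^ ('s::{finite,wellorder}) ^ ('s::{finite,wellorder})"
    and p q :: "'s \<Rightarrow> 'v \<Rightarrow> real"
  assumes explicit: "\<And>i j. i \<le> j \<Longrightarrow> At $ i $ j = 0"
    and implicit: "\<And>i j. i < j \<Longrightarrow> A $ i $ j = 0" and A: "invertible A"
    and stage: "\<And>i v. (\<Sum>j\<in>UNIV. At $ i $ j * p j v) + (\<Sum>j\<in>UNIV. A $ i $ j * q j v) = 0"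
    and transfer: "\<And>j. (\<forall>v. q j v = 0) \<Longrightarrow> \<forall>v. p j v = 0"
  shows "\<forall>v. q i v = 0"
proof (induction i rule: less_induct)
  case (less i)
  have "det A = (\<Prod>k\<in>UNIV. A $ k $ k)" by (rule det_lowerdiagonal) (rule implicit)
  then have diag: "A $ i $ i \<noteq> 0" using A by (simp add: invertible_det_nz)
  show ?case
  proof
    fix v
    have "At $ i $ j * p j v = 0" for j
      using explicit[of i j] transfer[of j] less[of j] by (cases "i \<le> j") auto
    then have "(\<Sum>j\<in>UNIV. At $ i $ j * p j v) = 0"
      by (intro sum.neutral ballI)
    moreover have "A $ i $ j * q j v = (if j = i then A $ i $ i * q i v else 0)" for j
      using implicit[of i j] less[of j] by (cases i j rule: linorder_cases) auto
    then have "(\<Sum>j\<in>UNIV. A $ i $ j * q j v) = (\<Sum>j\<in>UNIV. if j = i then A $ i $ i * q i v else 0)"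
      by (intro sum.cong refl)
    then have "(\<Sum>j\<in>UNIV. A $ i $ j * q j v) = A $ i $ i * q i v"
      by simp
    ultimately have "A $ i $ i * q i v = 0"
      using stage[of i v] by linarith
    with diag show "q i v = 0" by simp
  qed
qed

text \<open>
  Multiplied by \<open>\<epsilon>\<close>, the left-hand side \<open>\<epsilon> (F - f)\<close> and the transport part \<open>\<epsilon> L\<close> tend to zero,
  since \<open>F\<close>, \<open>f\<close> and \<open>L\<close> converge.
\<close>
lemma relaxation_limit:
  fixes F f :: "real \<Rightarrow> real" and P L Q :: "'s::finite \<Rightarrow> real \<Rightarrow> real"
  assumes stage: "\<And>\<epsilon>. 0 < \<epsilon> \<Longrightarrow> F \<epsilon> = f \<epsilon>
      + dt * (\<Sum>j\<in>UNIV. b j * (1 / \<epsilon> * P j \<epsilon> + L j \<epsilon>)) + dt / \<epsilon> * (\<Sum>j\<in>UNIV. a j * Q j \<epsilon>)"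
    and dt: "dt \<noteq> 0"
    and lims: "(F \<longlongrightarrow> F') (at_right 0)" "(f \<longlongrightarrow> f') (at_right 0)"
      "\<And>j. (P j \<longlongrightarrow> P' j) (at_right 0)" "\<And>j. (L j \<longlongrightarrow> L' j) (at_right 0)"
      "\<And>j. (Q j \<longlongrightarrow> Q' j) (at_right 0)"
  shows "(\<Sum>j\<in>UNIV. b j * P' j) + (\<Sum>j\<in>UNIV. a j * Q' j) = 0"
proof -
  have id: "((\<lambda>\<epsilon>::real. \<epsilon>) \<longlongrightarrow> 0) (at_right 0)" by (rule tendsto_ident_at)
  have lim: "((\<lambda>\<epsilon>. dt * ((\<Sum>j\<in>UNIV. b j * (P j \<epsilon> + \<epsilon> * L j \<epsilon>)) + (\<Sum>j\<in>UNIV. a j * Q j \<epsilon>)))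
      \<longlongrightarrow> dt * ((\<Sum>j\<in>UNIV. b j * (P' j + 0 * L' j)) + (\<Sum>j\<in>UNIV. a j * Q' j))) (at_right 0)"
    by (intro tendsto_intros lims id)
  have scaled: "((\<lambda>\<epsilon>. \<epsilon> * (F \<epsilon> - f \<epsilon>)) \<longlongrightarrow> 0 * (F' - f')) (at_right 0)"
    by (intro tendsto_intros lims id)
  have "\<epsilon> * (F \<epsilon> - f \<epsilon>)
      = dt * ((\<Sum>j\<in>UNIV. b j * (P j \<epsilon> + \<epsilon> * L j \<epsilon>)) + (\<Sum>j\<in>UNIV. a j * Q j \<epsilon>))" if "\<epsilon> > 0" for \<epsilon>
  proof -
    have "(\<Sum>j\<in>UNIV. b j * (P j \<epsilon> + \<epsilon> * L j \<epsilon>)) = \<epsilon> * (\<Sum>j\<in>UNIV. b j * (1 / \<epsilon> * P j \<epsilon> + L j \<epsilon>))"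
      unfolding sum_distrib_left using that by (intro sum.cong refl) (simp add: field_simps)
    then show ?thesis using that by (simp add: stage[OF that] field_simps)
  qed
  then have "eventually (\<lambda>\<epsilon>. \<epsilon> * (F \<epsilon> - f \<epsilon>)
      = dt * ((\<Sum>j\<in>UNIV. b j * (P j \<epsilon> + \<epsilon> * L j \<epsilon>)) + (\<Sum>j\<in>UNIV. a j * Q j \<epsilon>))) (at_right 0)"
    using eventually_at_right_less[of "0::real"] by (auto elim: eventually_mono)
  from Lim_transform_eventually[OF scaled this]
  have "((\<lambda>\<epsilon>. dt * ((\<Sum>j\<in>UNIV. b j * (P j \<epsilon> + \<epsilon> * L j \<epsilon>)) + (\<Sum>j\<in>UNIV. a j * Q j \<epsilon>)))
      \<longlongrightarrow> 0 * (F' - f')) (at_right 0)" .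
  from tendsto_unique[OF _ lim this]
  have "dt * ((\<Sum>j\<in>UNIV. b j * (P' j + 0 * L' j)) + (\<Sum>j\<in>UNIV. a j * Q' j)) = 0 * (F' - f')"
    by simp
  then show ?thesis using dt by simp
qed

lemma imex_step_stage_moments:
  fixes At A :: "real ^ 's ^ 's::finite"
  assumes step: "imex_step \<iota> \<Omega> GP QP At wt A w dt \<epsilon> f F f'" and x: "x \<in> \<Omega>"
    and f: "integrable lborel (\<lambda>v. f x v *\<^sub>R phi v)"
    and GP: "conservative D GP" and QP: "conservative D QP" and F: "\<And>j. F j x \<in> D"
    and L: "\<And>j. integrable lborel (\<lambda>v. transport \<iota> (F j) x v *\<^sub>R phi v)"
  shows "moments (F i x) = moments (f x) + dt *\<^sub>R (\<Sum>j\<in>UNIV. At $ i $ j *\<^sub>R moments (transport \<iota> (F j) x))"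
proof -
  have G0: "has_bochner_integral lborel (\<lambda>v. GP (F j x) v *\<^sub>R phi v) 0"
    and Q0: "has_bochner_integral lborel (\<lambda>v. QP (F j x) v *\<^sub>R phi v) 0" for j
    using GP QP F by (auto simp: conservative_def)
  have "has_bochner_integral lborel (\<lambda>v. f x v *\<^sub>R phi v
      + dt *\<^sub>R (\<Sum>j\<in>UNIV. At $ i $ j *\<^sub>R ((1 / \<epsilon>) *\<^sub>R (GP (F j x) v *\<^sub>R phi v) + transport \<iota> (F j) x v *\<^sub>R phi v))
      + (dt / \<epsilon>) *\<^sub>R (\<Sum>j\<in>UNIV. A $ i $ j *\<^sub>R (QP (F j x) v *\<^sub>R phi v)))
    (moments (f x)
      + dt *\<^sub>R (\<Sum>j\<in>UNIV. At $ i $ j *\<^sub>R ((1 / \<epsilon>) *\<^sub>R 0 + moments (transport \<iota> (F j) x)))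
      + (dt / \<epsilon>) *\<^sub>R (\<Sum>j\<in>UNIV. A $ i $ j *\<^sub>R 0))"
    unfolding moments_def
    by (intro has_bochner_integral_add has_bochner_integral_scaleR_right has_bochner_integral_sum
        G0 Q0 has_bochner_integral_integrable L f)
  moreover have "f x v *\<^sub>R phi v
      + dt *\<^sub>R (\<Sum>j\<in>UNIV. At $ i $ j *\<^sub>R ((1 / \<epsilon>) *\<^sub>R (GP (F j x) v *\<^sub>R phi v) + transport \<iota> (F j) x v *\<^sub>R phi v))
      + (dt / \<epsilon>) *\<^sub>R (\<Sum>j\<in>UNIV. A $ i $ j *\<^sub>R (QP (F j x) v *\<^sub>R phi v)) = F i x v *\<^sub>R phi v" for v
    unfolding imex_step_stage[OF step x, of i v]
    by (simp add: scaleR_left_distrib scaleR_right_distrib scaleR_sum_left scaleR_sum_right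
        sum_distrib_left sum_divide_distrib distrib_left mult.assoc)
  ultimately show ?thesis by (simp add: moments_def has_bochner_integral_iff)
qed

lemma has_bochner_integral_combination_moments:
  fixes c :: "'s::finite \<Rightarrow> real"
  assumes "integrable lborel (\<lambda>v. f v *\<^sub>R phi v)" "\<And>i. integrable lborel (\<lambda>v. F i v *\<^sub>R phi v)"
  shows "has_bochner_integral lborel (\<lambda>v. (f v + (\<Sum>i\<in>UNIV. c i * (F i v - f v))) *\<^sub>R phi v)
      (moments f + (\<Sum>i\<in>UNIV. c i *\<^sub>R (moments (F i) - moments f)))"
proof -
  have "has_bochner_integral lborel
      (\<lambda>v. f v *\<^sub>R phi v + (\<Sum>i\<in>UNIV. c i *\<^sub>R (F i v *\<^sub>R phi v - f v *\<^sub>R phi v)))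
      (moments f + (\<Sum>i\<in>UNIV. c i *\<^sub>R (moments (F i) - moments f)))"
    unfolding moments_def
    by (intro has_bochner_integral_add has_bochner_integral_sum has_bochner_integral_scaleR_right
        has_bochner_integral_diff has_bochner_integral_integrable assms)
  then show ?thesis
    by (simp add: scaleR_left_distrib scaleR_sum_left scaleR_left_diff_distrib flip: scaleR_scaleR)
qed

lemma conservative_penalized:
  assumes "conservative D (boltzmann B)" "conservative D QP"
  shows "conservative D (penalized B QP)"
  unfolding conservative_def
proof
  fix g assume "g \<in> D"
  then have "has_bochner_integral lborel
      (\<lambda>v. boltzmann B g v *\<^sub>R phi v - QP g v *\<^sub>R phi v) (0 - 0)"
    using assms by (intro has_bochner_integral_diff) (auto simp: conservative_def)
  then show "has_bochner_integral lborel (\<lambda>v. penalized B QP g v *\<^sub>R phi v) 0"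
    by (simp add: penalized_def scaleR_left_diff_distrib)
qed

theorem theorem4p1:
  fixes \<Omega> :: "(real ^ 'd::finite) set"
    and \<iota> :: "'d \<Rightarrow> 3"
    and B :: "real \<Rightarrow> vel \<Rightarrow> real"
    and QP :: "(vel \<Rightarrow> real) \<Rightarrow> vel \<Rightarrow> real"
    and D :: "(vel \<Rightarrow> real) set"
    and At A :: "real ^ ('s::{finite,wellorder}) ^ ('s::{finite,wellorder})"
    and wt w :: "real ^ ('s::{finite,wellorder})"
    and dt :: real
    and n :: nat
    and f :: "real \<Rightarrow> nat \<Rightarrow> real ^ 'd \<Rightarrow> vel \<Rightarrow> real"
    and F :: "real \<Rightarrow> 's \<Rightarrow> real ^ 'd \<Rightarrow> vel \<Rightarrow> real"
    and f0 :: "real ^ 'd \<Rightarrow> vel \<Rightarrow> real"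
    and F0 :: "'s \<Rightarrow> real ^ 'd \<Rightarrow> vel \<Rightarrow> real"
  assumes domain: "open \<Omega>" "inj \<iota>"
    and D: "\<And>g. g \<in> D \<Longrightarrow> distribution_function g"
    and B_nonneg: "\<And>r \<sigma>. 0 \<le> r \<Longrightarrow> norm \<sigma> = 1 \<Longrightarrow> 0 \<le> B r \<sigma>"
    and QB: "conservative D (boltzmann B)" "maxwellian_equilibria D (boltzmann B)"
    and QP: "conservative D QP" "maxwellian_equilibria D QP"
    and explicit: "\<And>i j. i \<le> j \<Longrightarrow> At $ i $ j = 0"
    and implicit: "\<And>i j. i < j \<Longrightarrow> A $ i $ j = 0"
    and type_A: "invertible A"
    and weights: "wt = w v* (matrix_inv A ** At)"
    and dt: "0 < dt"
    and scheme: "\<And>\<epsilon>. 0 < \<epsilon> \<Longrightarrow>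
      imex_step \<iota> \<Omega> (penalized B QP) QP At wt A w dt \<epsilon> (f \<epsilon> n) (F \<epsilon>) (f \<epsilon> (Suc n))"
    and f_D: "\<And>\<epsilon> x. 0 < \<epsilon> \<Longrightarrow> x \<in> \<Omega> \<Longrightarrow> f \<epsilon> n x \<in> D"
    and F_D: "\<And>\<epsilon> i x. 0 < \<epsilon> \<Longrightarrow> x \<in> \<Omega> \<Longrightarrow> F \<epsilon> i x \<in> D"
    and F_diff: "\<And>\<epsilon> i x v. 0 < \<epsilon> \<Longrightarrow> x \<in> \<Omega> \<Longrightarrow> (\<lambda>y. F \<epsilon> i y v) differentiable (at x)"
    and L_moments: "\<And>\<epsilon> i x. 0 < \<epsilon> \<Longrightarrow> x \<in> \<Omega> \<Longrightarrow>
      integrable lborel (\<lambda>v. transport \<iota> (F \<epsilon> i) x v *\<^sub>R phi v)"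
    and f0_D: "\<And>x. x \<in> \<Omega> \<Longrightarrow> f0 x \<in> D"
    and F0_D: "\<And>i x. x \<in> \<Omega> \<Longrightarrow> F0 i x \<in> D"
    and F0_diff: "\<And>i x v. x \<in> \<Omega> \<Longrightarrow> (\<lambda>y. F0 i y v) differentiable (at x)"
    and f_lim: "\<And>x v. x \<in> \<Omega> \<Longrightarrow> ((\<lambda>\<epsilon>. f \<epsilon> n x v) \<longlongrightarrow> f0 x v) (at_right 0)"
    and F_lim: "\<And>i x v. x \<in> \<Omega> \<Longrightarrow> ((\<lambda>\<epsilon>. F \<epsilon> i x v) \<longlongrightarrow> F0 i x v) (at_right 0)"
    and QP_lim: "\<And>i x v. x \<in> \<Omega> \<Longrightarrow>
      ((\<lambda>\<epsilon>. QP (F \<epsilon> i x) v) \<longlongrightarrow> QP (F0 i x) v) (at_right 0)"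
    and GP_lim: "\<And>i x v. x \<in> \<Omega> \<Longrightarrow>
      ((\<lambda>\<epsilon>. penalized B QP (F \<epsilon> i x) v) \<longlongrightarrow> penalized B QP (F0 i x) v) (at_right 0)"
    and L_lim: "\<And>i x v. x \<in> \<Omega> \<Longrightarrow>
      ((\<lambda>\<epsilon>. transport \<iota> (F \<epsilon> i) x v) \<longlongrightarrow> transport \<iota> (F0 i) x v) (at_right 0)"
    and M_lim: "\<And>i x v. x \<in> \<Omega> \<Longrightarrow>
      ((\<lambda>\<epsilon>. maxwellian (F \<epsilon> i x) v) \<longlongrightarrow> maxwellian (F0 i x) v) (at_right 0)"
    and f_mom_lim: "\<And>x. x \<in> \<Omega> \<Longrightarrow>
      ((\<lambda>\<epsilon>. moments (f \<epsilon> n x)) \<longlongrightarrow> moments (f0 x)) (at_right 0)"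
    and F_mom_lim: "\<And>i x. x \<in> \<Omega> \<Longrightarrow>
      ((\<lambda>\<epsilon>. moments (F \<epsilon> i x)) \<longlongrightarrow> moments (F0 i x)) (at_right 0)"
    and L_mom_lim: "\<And>i x. x \<in> \<Omega> \<Longrightarrow>
      ((\<lambda>\<epsilon>. moments (transport \<iota> (F \<epsilon> i) x)) \<longlongrightarrow> moments (transport \<iota> (F0 i) x)) (at_right 0)"
  shows
    "(\<forall>i. \<forall>x\<in>\<Omega>. F0 i x = maxwellian (F0 i x)) \<and>
     (\<forall>i k. \<forall>x\<in>\<Omega>. (\<lambda>y. euler_flux (moments (F0 i y)) (\<iota> k)) differentiable (at x)) \<and>
     (\<forall>i. \<forall>x\<in>\<Omega>. moments (F0 i x) =
        moments (f0 x) - dt *\<^sub>R (\<Sum>j<i. At $ i $ j *\<^sub>R div_euler_flux \<iota> (\<lambda>y. moments (F0 j y)) x)) \<and>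
     (\<exists>f1 :: real ^ 'd \<Rightarrow> vel \<Rightarrow> real. \<forall>x\<in>\<Omega>.
        (\<forall>v. ((\<lambda>\<epsilon>. f \<epsilon> (Suc n) x v) \<longlongrightarrow> f1 x v) (at_right 0)) \<and>
        integrable lborel (\<lambda>v. f1 x v *\<^sub>R phi v) \<and>
        ((\<lambda>\<epsilon>. moments (f \<epsilon> (Suc n) x)) \<longlongrightarrow> moments (f1 x)) (at_right 0) \<and>
        moments (f1 x) =
          moments (f0 x) - dt *\<^sub>R (\<Sum>i\<in>UNIV. wt $ i *\<^sub>R div_euler_flux \<iota> (\<lambda>y. moments (F0 i y)) x))"
proof -
  define L0 where "L0 i x = moments (transport \<iota> (F0 i) x)" for i x
  define c where "c = w v* matrix_inv A"
  have stage_limit: "(\<Sum>j\<in>UNIV. At $ i $ j * penalized B QP (F0 j x) v)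
      + (\<Sum>j\<in>UNIV. A $ i $ j * QP (F0 j x) v) = 0" if x: "x \<in> \<Omega>" for i x v
    by (rule relaxation_limit[OF imex_step_stage[OF scheme x] _ F_lim[OF x] f_lim[OF x] GP_lim[OF x]
          L_lim[OF x] QP_lim[OF x]]) (use dt in auto)
  have QP_zero: "\<forall>v. QP (F0 i x) v = 0" if x: "x \<in> \<Omega>" for i x
  proof (rule lower_triangular_cascade[OF explicit implicit type_A stage_limit[OF x]])
    fix j assume "\<forall>v. QP (F0 j x) v = 0"
    moreover from this have "F0 j x = maxwellian (F0 j x)"
      using QP(2) F0_D[OF x, of j] unfolding maxwellian_equilibria_def by blast
    then have "\<forall>v. boltzmann B (F0 j x) v = 0"
      using QB(2) F0_D[OF x, of j] unfolding maxwellian_equilibria_def by blast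
    ultimately show "\<forall>v. penalized B QP (F0 j x) v = 0" by (simp add: penalized_def)
  qed
  have maxwell: "F0 i x = maxwellian (F0 i x)" if "x \<in> \<Omega>" for i x
    using QP_zero[OF that] QP(2) F0_D[OF that, of i] unfolding maxwellian_equilibria_def by blast
  have equilibrium: "local_equilibrium (F0 i x)" if "x \<in> \<Omega>" for i x
    using maxwell[OF that] D[OF F0_D[OF that]] unfolding local_equilibrium_def by blast
  \<comment> \<open>As \<open>\<Omega>\<close> is open, the stage is Maxwellian in a whole neighbourhood of \<open>x\<close>, as the derivative requires.\<close>
  have L0: "L0 i x = - div_euler_flux \<iota> (\<lambda>y. moments (F0 i y)) x" if "x \<in> \<Omega>" for i x
    unfolding L0_def by (rule moments_transport_local_equilibrium[OF domain(1) that equilibrium F0_diff[OF that]])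
  have flux_diff: "(\<lambda>y. euler_flux (moments (F0 i y)) (\<iota> k)) differentiable (at x)" if "x \<in> \<Omega>" for i k x
    using local_equilibrium_flux_has_derivative(2)[OF domain(1) that equilibrium F0_diff[OF that]]
    unfolding differentiable_def by blast
  have int: "integrable lborel (\<lambda>v. g v *\<^sub>R phi v)" if "g \<in> D" for g
    using D[OF that] by (simp add: distribution_function_def)
  have stage_moments: "moments (F0 i x) = moments (f0 x) + dt *\<^sub>R (\<Sum>j\<in>UNIV. At $ i $ j *\<^sub>R L0 j x)"
    if x: "x \<in> \<Omega>" for i x
  proof (rule tendsto_unique[OF _ F_mom_lim[OF x]])
    have "((\<lambda>\<epsilon>. moments (f \<epsilon> n x) + dt *\<^sub>R (\<Sum>j\<in>UNIV. At $ i $ j *\<^sub>R moments (transport \<iota> (F \<epsilon> j) x)))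
        \<longlongrightarrow> moments (f0 x) + dt *\<^sub>R (\<Sum>j\<in>UNIV. At $ i $ j *\<^sub>R L0 j x)) (at_right 0)"
      unfolding L0_def by (intro tendsto_intros f_mom_lim L_mom_lim x)
    moreover have "eventually (\<lambda>\<epsilon>. moments (f \<epsilon> n x)
          + dt *\<^sub>R (\<Sum>j\<in>UNIV. At $ i $ j *\<^sub>R moments (transport \<iota> (F \<epsilon> j) x)) = moments (F \<epsilon> i x)) (at_right 0)"
      using eventually_at_right_less[of "0::real"]
    proof eventually_elim
      case (elim \<epsilon>)
      show ?case
        by (rule imex_step_stage_moments[OF scheme[OF elim] x int[OF f_D[OF elim x]]
              conservative_penalized[OF QB(1) QP(1)] QP(1) F_D[OF elim x] L_moments[OF elim x], symmetric])
    qed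
    ultimately show "((\<lambda>\<epsilon>. moments (F \<epsilon> i x))
        \<longlongrightarrow> moments (f0 x) + dt *\<^sub>R (\<Sum>j\<in>UNIV. At $ i $ j *\<^sub>R L0 j x)) (at_right 0)"
      by (rule Lim_transform_eventually)
  qed simp
  have stages: "moments (F0 i x) = moments (f0 x)
      - dt *\<^sub>R (\<Sum>j<i. At $ i $ j *\<^sub>R div_euler_flux \<iota> (\<lambda>y. moments (F0 j y)) x)" if x: "x \<in> \<Omega>" for i x
  proof -
    have "(\<Sum>j\<in>UNIV. At $ i $ j *\<^sub>R L0 j x) = (\<Sum>j<i. At $ i $ j *\<^sub>R L0 j x)"
      by (rule sum.mono_neutral_right) (auto simp: explicit)
    also have "\<dots> = - (\<Sum>j<i. At $ i $ j *\<^sub>R div_euler_flux \<iota> (\<lambda>y. moments (F0 j y)) x)"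
      by (simp add: L0[OF x] sum_negf)
    finally show ?thesis by (simp add: stage_moments[OF x])
  qed
  define f1 where "f1 x v = f0 x v + (\<Sum>i\<in>UNIV. c $ i * (F0 i x v - f0 x v))" for x v
  have update: "f \<epsilon> (Suc n) x = (\<lambda>v. f \<epsilon> n x v + (\<Sum>i\<in>UNIV. c $ i * (F \<epsilon> i x v - f \<epsilon> n x v)))"
    if "0 < \<epsilon>" "x \<in> \<Omega>" for \<epsilon> x
    unfolding c_def using imex_step_update_from_stages[OF scheme[OF that(1)] that(2) type_A weights] by blast
  have final: "(\<forall>v. ((\<lambda>\<epsilon>. f \<epsilon> (Suc n) x v) \<longlongrightarrow> f1 x v) (at_right 0)) \<and>
        integrable lborel (\<lambda>v. f1 x v *\<^sub>R phi v) \<and>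
        ((\<lambda>\<epsilon>. moments (f \<epsilon> (Suc n) x)) \<longlongrightarrow> moments (f1 x)) (at_right 0) \<and>
        moments (f1 x) =
          moments (f0 x) - dt *\<^sub>R (\<Sum>i\<in>UNIV. wt $ i *\<^sub>R div_euler_flux \<iota> (\<lambda>y. moments (F0 i y)) x)"
    if x: "x \<in> \<Omega>" for x
  proof (intro conjI allI)
    show "((\<lambda>\<epsilon>. f \<epsilon> (Suc n) x v) \<longlongrightarrow> f1 x v) (at_right 0)" for v
    proof (rule Lim_transform_eventually)
      show "((\<lambda>\<epsilon>. f \<epsilon> n x v + (\<Sum>i\<in>UNIV. c $ i * (F \<epsilon> i x v - f \<epsilon> n x v))) \<longlongrightarrow> f1 x v) (at_right 0)"
        unfolding f1_def by (intro tendsto_intros f_lim F_lim x)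
      show "eventually (\<lambda>\<epsilon>. f \<epsilon> n x v + (\<Sum>i\<in>UNIV. c $ i * (F \<epsilon> i x v - f \<epsilon> n x v))
          = f \<epsilon> (Suc n) x v) (at_right 0)"
        using eventually_at_right_less[of "0::real"] by eventually_elim (simp add: update x)
    qed
    have f1: "has_bochner_integral lborel (\<lambda>v. f1 x v *\<^sub>R phi v)
        (moments (f0 x) + (\<Sum>i\<in>UNIV. c $ i *\<^sub>R (moments (F0 i x) - moments (f0 x))))"
      unfolding f1_def
      by (intro has_bochner_integral_combination_moments int f0_D F0_D x)
    then show "integrable lborel (\<lambda>v. f1 x v *\<^sub>R phi v)" by (simp add: has_bochner_integral_iff)
    have mom_f1: "moments (f1 x) = moments (f0 x) + (\<Sum>i\<in>UNIV. c $ i *\<^sub>R (moments (F0 i x) - moments (f0 x)))"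
      using f1 unfolding moments_def[of "f1 x"] by (simp add: has_bochner_integral_iff)
    show "((\<lambda>\<epsilon>. moments (f \<epsilon> (Suc n) x)) \<longlongrightarrow> moments (f1 x)) (at_right 0)"
    proof (rule Lim_transform_eventually)
      show "((\<lambda>\<epsilon>. moments (f \<epsilon> n x) + (\<Sum>i\<in>UNIV. c $ i *\<^sub>R (moments (F \<epsilon> i x) - moments (f \<epsilon> n x))))
          \<longlongrightarrow> moments (f1 x)) (at_right 0)"
        unfolding mom_f1 by (intro tendsto_intros f_mom_lim F_mom_lim x)
      show "eventually (\<lambda>\<epsilon>. moments (f \<epsilon> n x) + (\<Sum>i\<in>UNIV. c $ i *\<^sub>R (moments (F \<epsilon> i x) - moments (f \<epsilon> n x)))
          = moments (f \<epsilon> (Suc n) x)) (at_right 0)"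
        using eventually_at_right_less[of "0::real"]
      proof eventually_elim
        case (elim \<epsilon>)
        have "has_bochner_integral lborel (\<lambda>v. f \<epsilon> (Suc n) x v *\<^sub>R phi v)
          (moments (f \<epsilon> n x) + (\<Sum>i\<in>UNIV. c $ i *\<^sub>R (moments (F \<epsilon> i x) - moments (f \<epsilon> n x))))"
          unfolding update[OF elim x]
          by (intro has_bochner_integral_combination_moments int f_D F_D x elim)
        then show ?case
          unfolding moments_def[of "f \<epsilon> (Suc n) x"] by (simp add: has_bochner_integral_iff)
      qed
    qed
    have wt: "wt $ j = (\<Sum>i\<in>UNIV. c $ i * At $ i $ j)" for j
    proof -
      have "wt = c v* At" by (simp add: c_def weights vector_matrix_mul_assoc)
      then show ?thesis by (simp add: vector_matrix_mult_def mult.commute)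
    qed
    have "(\<Sum>i\<in>UNIV. c $ i *\<^sub>R (moments (F0 i x) - moments (f0 x)))
        = dt *\<^sub>R (\<Sum>i\<in>UNIV. \<Sum>j\<in>UNIV. (c $ i * At $ i $ j) *\<^sub>R L0 j x)"
      by (simp add: stage_moments[OF x] scaleR_sum_right mult_ac)
    also have "\<dots> = dt *\<^sub>R (\<Sum>j\<in>UNIV. wt $ j *\<^sub>R L0 j x)"
      by (subst sum.swap) (simp add: wt scaleR_sum_left)
    also have "\<dots> = - (dt *\<^sub>R (\<Sum>j\<in>UNIV. wt $ j *\<^sub>R div_euler_flux \<iota> (\<lambda>y. moments (F0 j y)) x))"
      by (simp add: L0[OF x] sum_negf)
    finally show "moments (f1 x) =
          moments (f0 x) - dt *\<^sub>R (\<Sum>i\<in>UNIV. wt $ i *\<^sub>R div_euler_flux \<iota> (\<lambda>y. moments (F0 i y)) x)"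
      using mom_f1 by simp
  qed
  show ?thesis
    by (rule conjI[OF _ conjI[OF _ conjI]]; (intro allI ballI exI[of _ f1])?; erule maxwell flux_diff stages final)
qed

end
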